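(* Let $f:\mathbb{R}^n_{>0}\to\mathbb{R}^n_{>0}$ be order-preserving, homogeneous, and multiplicatively convex. (a) $E(f)$ is nonempty and bounded in $(\mathbb{R}^n_{>0},d_H)$ if and only if $f$ is strongly nonnegative and $\mathcal{G}(f)$ has only one final class. (b) If $f$ is strongly nonnegative, then $E(f)$ is nonempty. (c) If $f$ is real analytic and $E(f)$ is nonempty, then $f$ is strongly nonnegative.
   Context: $[n]=\{1,\dots,n\}$; entrywise order. Order-preserving: $x\le y\Rightarrow f(x)\le f(y)$; homogeneous: $f(tx)=tf(x)$ for $t>0$. Multiplicatively convex: each entry of $\log\circ f\circ\exp$ is convex. Real analytic: each entry of $f$ is real analytic on $\mathbb{R}^n_{>0}$. $d_H(x,y)=\log\max_{i,j}\frac{y_ix_j}{x_iy_j}$; $E(f)=\{x\in\mathbb{R}^n_{>0}:f(x)=\mu x \text{ for some }\mu\}$. $f$ extends continuously to an order-preserving homogeneous map on $\mathbb{R}^n_{\ge0}$, also denoted $f$. $P^J_0(x)_j=x_j$ for $j\in J$, $0$ otherwise; $f^J_0=P^J_0fP^J_0$. $r(g)=\inf_{x\in\mathbb{R}^n_{>0}}\max_ig(x)_i/x_i$. $\mathcal{G}(f)$ is the directed graph on $[n]$ with an arc $i\to j$ when $\lim_{t\to\infty}f(\exp(te_{\{j\}}))_i=\infty$. A final class is a strongly connected component of $\mathcal{G}(f)$ with no arcs leaving it. $f$ is strongly nonnegative if $r(f^C_0)=r(f)$ for every final class $C$ and $r(f^C_0)<r(f)$ for every strongly connected component $C$ that is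 not a final class. *)

theory Defs
  imports "HOL-Analysis.Analysis"
begin

definition pos_vec :: "real^'n \<Rightarrow> bool" where
  "pos_vec x \<longleftrightarrow> (\<forall>i. x $ i > 0)"

definition nonneg_vec :: "real^'n \<Rightarrow> bool" where
  "nonneg_vec x \<longleftrightarrow> (\<forall>i. x $ i \<ge> 0)"

definition vle :: "real^'n \<Rightarrow> real^'n \<Rightarrow> bool" where
  "vle x y \<longleftrightarrow> (\<forall>i. x $ i \<le> y $ i)"

definition maps_pos :: "(real^'n \<Rightarrow> real^'n) \<Rightarrow> bool" where
  "maps_pos f \<longleftrightarrow> (\<forall>x. pos_vec x \<longrightarrow> pos_vec (f x))"

definition order_preserving :: "(real^'n \<Rightarrow> real^'n) \<Rightarrow> bool" where
  "order_preserving f \<longleftrightarrow>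
     (\<forall>x y. pos_vec x \<longrightarrow> pos_vec y \<longrightarrow> vle x y \<longrightarrow> vle (f x) (f y))"

definition homogeneous :: "(real^'n \<Rightarrow> real^'n) \<Rightarrow> bool" where
  "homogeneous f \<longleftrightarrow> (\<forall>t x. t > 0 \<longrightarrow> pos_vec x \<longrightarrow> f (t *\<^sub>R x) = t *\<^sub>R f x)"

definition vexp :: "real^'n \<Rightarrow> real^'n" where
  "vexp y = (\<chi> i. exp (y $ i))"

definition mult_convex :: "(real^'n \<Rightarrow> real^'n) \<Rightarrow> bool" where
  "mult_convex f \<longleftrightarrow> (\<forall>j. convex_on UNIV (\<lambda>y. ln (f (vexp y) $ j)))"

definition real_analytic_at :: "(real^'n \<Rightarrow> real) \<Rightarrow> real^'n \<Rightarrow> bool" where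
  "real_analytic_at g x \<longleftrightarrow>
     (\<exists>c :: ('n \<Rightarrow> nat) \<Rightarrow> real. \<exists>r > 0. \<forall>h. norm h < r \<longrightarrow>
        ((\<lambda>\<alpha>. c \<alpha> * (\<Prod>i\<in>UNIV. (h $ i) ^ (\<alpha> i))) has_sum g (x + h)) UNIV)"

definition real_analytic_map :: "(real^'n \<Rightarrow> real^'n) \<Rightarrow> bool" where
  "real_analytic_map f \<longleftrightarrow> (\<forall>j x. pos_vec x \<longrightarrow> real_analytic_at (\<lambda>y. f y $ j) x)"

definition hilbert_dist :: "real^'n \<Rightarrow> real^'n \<Rightarrow> real" where
  "hilbert_dist x y = ln (Max {(y $ i * x $ j) / (x $ i * y $ j) | i j. True})"

definition eigvecs :: "(real^'n \<Rightarrow> real^'n) \<Rightarrow> (real^'n) set" where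
  "eigvecs f = {x. pos_vec x \<and> (\<exists>\<mu>. f x = \<mu> *\<^sub>R x)}"

definition hbounded :: "(real^'n) set \<Rightarrow> bool" where
  "hbounded S \<longleftrightarrow> (\<exists>R. \<forall>x\<in>S. \<forall>y\<in>S. hilbert_dist x y \<le> R)"

text \<open>The continuous extension of f to the closed cone:
  ext f x = lim_{eps -> 0+} f (x + eps 1) (a decreasing limit, bounded below by 0).\<close>
definition cone_ext :: "(real^'n \<Rightarrow> real^'n) \<Rightarrow> real^'n \<Rightarrow> real^'n" where
  "cone_ext f x = (\<chi> i. Inf {f (x + e *\<^sub>R (\<chi> k. 1)) $ i | e. e > 0})"

definition proj0 :: "'n set \<Rightarrow> real^'n \<Rightarrow> real^'n" where
  "proj0 J x = (\<chi> j. if j \<in> J then x $ j else 0)"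

definition restr0 :: "'n set \<Rightarrow> (real^'n \<Rightarrow> real^'n) \<Rightarrow> real^'n \<Rightarrow> real^'n" where
  "restr0 J f = proj0 J \<circ> cone_ext f \<circ> proj0 J"

definition cw_radius :: "(real^'n \<Rightarrow> real^'n) \<Rightarrow> real" where
  "cw_radius g = Inf ((\<lambda>x. Max (range (\<lambda>i. g x $ i / x $ i))) ` {x. pos_vec x})"

definition unit_exp :: "'n \<Rightarrow> real \<Rightarrow> real^'n" where
  "unit_exp j t = (\<chi> k. if k = j then exp t else 1)"

definition garc :: "(real^'n \<Rightarrow> real^'n) \<Rightarrow> 'n \<Rightarrow> 'n \<Rightarrow> bool" where
  "garc f i j \<longleftrightarrow> filterlim (\<lambda>t. f (unit_exp j t) $ i) at_top at_top"

definition scc_of :: "(real^'n \<Rightarrow> real^'n) \<Rightarrow> 'n \<Rightarrow> 'n set" where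
  "scc_of f i = {j. (garc f)\<^sup>*\<^sup>* i j \<and> (garc f)\<^sup>*\<^sup>* j i}"

definition is_scc :: "(real^'n \<Rightarrow> real^'n) \<Rightarrow> 'n set \<Rightarrow> bool" where
  "is_scc f C \<longleftrightarrow> (\<exists>i. C = scc_of f i)"

definition final_class :: "(real^'n \<Rightarrow> real^'n) \<Rightarrow> 'n set \<Rightarrow> bool" where
  "final_class f C \<longleftrightarrow> is_scc f C \<and> (\<forall>a\<in>C. \<forall>b. garc f a b \<longrightarrow> b \<in> C)"

definition strongly_nonneg :: "(real^'n \<Rightarrow> real^'n) \<Rightarrow> bool" where
  "strongly_nonneg f \<longleftrightarrow>
     (\<forall>C. final_class f C \<longrightarrow> cw_radius (restr0 C f) = cw_radius f) \<and>
     (\<forall>C. is_scc f C \<and> \<not> final_class f C \<longrightarrow> cw_radius (restr0 C f) < cw_radius f)"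

end

(* In logarithmic coordinates f becomes a monotone map T that commutes with adding constants
   and has convex components. Convexity makes an arc i -> j of the graph of f equivalent to T_i
   depending on the j-th coordinate at all, and r(f^C_0) < exp c equivalent to T v < v + c on C
   for some vector v. After subtracting c from T, eigenvectors are fixed points of T.

   A final class carries an eigenvector because the discounted fixed points stay bounded, up to a
   shift, on a strongly connected set. A fixed point on an absorbing set extends to a further
   non-final class: v is a supersolution, and large outside values produce a subsolution.
   Boundedness of the set of fixed points propagates along the classes in the same way. Conversely,
   a fixed point can be shifted on one absorbing set and kept on another, which produces unbounded
   families of fixed points unless the final class is unique and every non-final class admits
   such a v. For analytic f, strict dependence on every coordinate yields v directly. *)

theory Submission
  imports Defs "HOL-Complex_Analysis.Cauchy_Integral_Formula"
begin

section \<open>Convex monotone maps commuting with constants\<close>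

text \<open>The obstacle is that an arc acts in one direction only. A convex nondecreasing function
  may be flat on a half-line before it grows, as \<open>max 0 t\<close> is, so an arc i -> j forces
  entry i of \<open>T x\<close> up once entry j of x is large, but says nothing about lowering entry
  j. Hence upper bounds along paths and subsolutions come from the graph alone, whereas a
  supersolution on a non-final class has to be supplied; this is what the strict inequality of radii
  encodes. Analyticity excludes the flat part, so that lowering travels along arcs too. Fixed points
  mostly come from iteration between a subsolution and a supersolution. On a strongly connected
  absorbing set no such pair is at hand, because the eigenvalue is not known beforehand. The maps
  \<open>(1 - e) *\<^sub>R T x\<close> always have a fixed point, and e times its least entry tends,
  along a subsequence, to the eigenvalue.\<close>

lemma finite_growth_induct:
  fixes P :: "'a::finite set \<Rightarrow> bool"
  assumes "P S" and "\<And>S. P S \<Longrightarrow> S \<noteq> UNIV \<Longrightarrow> \<exists>S'. S \<subset> S' \<and> P S'"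
  shows "P UNIV"
  using assms(1)
proof (induction "card (- S)" arbitrary: S rule: less_induct)
  case less
  show ?case
  proof (cases "S = UNIV")
    case False
    then obtain S' where S': "S \<subset> S'" "P S'"
      using assms(2) less.prems by blast
    then have "card (- S') < card (- S)"
      by (intro psubset_card_mono) auto
    with less.hyps S'(2) show ?thesis by blast
  qed (use less.prems in simp)
qed

lemma rtranclp_crossing:
  assumes "r\<^sup>*\<^sup>* i j" "i \<notin> S" "j \<in> S"
  shows "\<exists>a b. a \<notin> S \<and> b \<in> S \<and> r a b"
  using assms
proof (induction rule: converse_rtranclp_induct)
  case (step y z)
  show ?case
  proof (cases "z \<in> S")
    case False
    with step show ?thesis by blast
  qed (use step in blast)
qed simp

text \<open>The iterates from the supersolution decrease and stay above the subsolution, so they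
  converge entrywise, and continuity makes the limit a fixed point. Convergence is part of the
  conclusion because one later argument averages the iterates themselves.\<close>

lemma monotone_iteration:
  fixes G :: "real^'n \<Rightarrow> real^'n"
  assumes mono: "\<And>x y. x \<le> y \<Longrightarrow> G x \<le> G y"
    and cont: "continuous_on UNIV G"
    and l: "l \<le> G l" and u: "G u \<le> u" and lu: "l \<le> u"
  shows "\<exists>z. G z = z \<and> l \<le> z \<and> z \<le> u \<and> (\<lambda>k. (G ^^ k) u) \<longlonglongrightarrow> z"
proof -
  define X where "X k = (G ^^ k) u" for k
  have XS: "X (Suc k) = G (X k)" for k by (simp add: X_def)
  have dec: "X (Suc k) \<le> X k" for k
  proof (induction k)
    case 0
    then show ?case using u by (simp add: X_def)
  next
    case (Suc k)
    then show ?case using mono XS by metis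
  qed
  have low: "l \<le> X k" for k
  proof (induction k)
    case 0
    then show ?case using lu by (simp add: X_def)
  next
    case (Suc k)
    then show ?case using mono XS l by (metis order_trans)
  qed
  have "\<exists>L. (\<lambda>k. X k $ i) \<longlonglongrightarrow> L" for i
  proof -
    have "decseq (\<lambda>k. X k $ i)" using dec by (simp add: decseq_Suc_iff less_eq_vec_def)
    moreover have "\<And>k. l $ i \<le> X k $ i" using low by (simp add: less_eq_vec_def)
    ultimately show ?thesis using decseq_convergent[of "\<lambda>k. X k $ i" "l $ i"] by blast
  qed
  then obtain L where L: "\<And>i. (\<lambda>k. X k $ i) \<longlonglongrightarrow> L i" by metis
  define z where "z = (\<chi> i. L i)"
  have lim: "X \<longlonglongrightarrow> z"
    using L by (auto intro!: vec_tendstoI simp: z_def)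
  have "(\<lambda>k. G (X k)) \<longlonglongrightarrow> G z"
    using cont lim continuous_on_tendsto_compose[of UNIV G X z] by simp
  moreover have "(\<lambda>k. G (X k)) \<longlonglongrightarrow> z"
    using lim LIMSEQ_Suc[OF lim] by (simp add: XS)
  ultimately have "G z = z" using LIMSEQ_unique by blast
  moreover have "l \<le> z"
    unfolding less_eq_vec_def
  proof
    fix i show "l $ i \<le> z $ i"
      using L[of i] low by (intro LIMSEQ_le_const[of "\<lambda>k. X k $ i"]) (auto simp: z_def less_eq_vec_def)
  qed
  moreover have "z \<le> u"
    unfolding less_eq_vec_def
  proof
    fix i
    have "X k \<le> u" for k
      using decseqD[of X 0 k] dec by (simp add: decseq_Suc_iff X_def)
    then show "z $ i \<le> u $ i"
      using L[of i] by (intro LIMSEQ_le_const2[of "\<lambda>k. X k $ i"]) (auto simp: z_def less_eq_vec_def)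
  qed
  ultimately show ?thesis using lim unfolding X_def by blast
qed

locale topical =
  fixes T :: "real^'n \<Rightarrow> real^'n"
  assumes mono: "x \<le> y \<Longrightarrow> T x \<le> T y"
    and shift: "T (x + vec c) = T x + vec c"
    and convex: "convex_on UNIV (\<lambda>x. T x $ i)"
begin

definition dep :: "'n \<Rightarrow> 'n \<Rightarrow> bool" where
  "dep i j \<longleftrightarrow> (\<exists>x y. (\<forall>k. k \<noteq> j \<longrightarrow> x $ k = y $ k) \<and> T x $ i \<noteq> T y $ i)"

text \<open>Closed under arcs, so that the entries of \<open>T x\<close> on \<open>D\<close> are
  determined by those of \<open>x\<close> on \<open>D\<close>: the map restricts to such a
  set.\<close>

definition absorbing :: "'n set \<Rightarrow> bool" where
  "absorbing D \<longleftrightarrow> (\<forall>i\<in>D. \<forall>j. dep i j \<longrightarrow> j \<in> D)"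

abbreviation reach :: "'n \<Rightarrow> 'n \<Rightarrow> bool" where
  "reach \<equiv> dep\<^sup>*\<^sup>*"

definition scc :: "'n \<Rightarrow> 'n set" where
  "scc i = {j. reach i j \<and> reach j i}"

lemma mono_comp: "(\<And>k. x $ k \<le> y $ k) \<Longrightarrow> T x $ i \<le> T y $ i"
  using mono[of x y] by (simp add: less_eq_vec_def)

lemma shift_comp: "T (x + vec c) $ i = T x $ i + c"
  by (simp add: shift)

lemma shift_minus_comp: "T (x - vec c) $ i = T x $ i - c"
  using shift_comp[of "x - vec c" c i] by simp

lemma nonexpansive: "T x $ i \<le> T y $ i + norm (x - y)"
proof -
  have "x $ k \<le> (y + vec (norm (x - y))) $ k" for k
    using component_le_norm_cart[of "x - y" k] by simp
  then have "T x $ i \<le> T (y + vec (norm (x - y))) $ i" by (rule mono_comp)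
  then show ?thesis by (simp only: shift_comp)
qed

lemma continuous_comp: "continuous_on UNIV (\<lambda>x. T x $ i)"
  unfolding continuous_on_iff
proof (intro ballI allI impI)
  fix x :: "real^'n" and e :: real
  assume "e > 0"
  moreover have "dist (T y $ i) (T x $ i) \<le> dist y x" for y
    using nonexpansive[of x i y] nonexpansive[of y i x]
    by (simp add: dist_real_def dist_norm norm_minus_commute abs_le_iff)
  ultimately show "\<exists>d>0. \<forall>x'\<in>UNIV. dist x' x < d \<longrightarrow> dist (T x' $ i) (T x $ i) < e"
    using le_less_trans by blast
qed

lemma continuous: "continuous_on UNIV T"
proof -
  have "continuous_on UNIV (\<lambda>x. \<chi> i. T x $ i)"
    by (intro continuous_on_vec_lambda continuous_comp)
  then show ?thesis by simp
qed

text \<open>\<open>dep\<close> only speaks of changing one coordinate, so the irrelevant coordinates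
  are exchanged one after the other.\<close>

lemma eq_off_independent:
  assumes "\<And>k. dep i k \<Longrightarrow> x $ k = y $ k"
  shows "T x $ i = T y $ i"
proof -
  have *: "finite K \<Longrightarrow> \<forall>k\<in>K. \<not> dep i k \<Longrightarrow> \<forall>k. k \<notin> K \<longrightarrow> x $ k = y $ k \<Longrightarrow> T x $ i = T y $ i" for K x y
  proof (induction K arbitrary: x rule: finite_induct)
    case empty
    then have "x = y" by (simp add: vec_eq_iff)
    then show ?case by simp
  next
    case (insert j K)
    define z where "z = (\<chi> k. if k = j then y $ k else x $ k)"
    have "T x $ i = T z $ i"
    proof -
      have "\<forall>k. k \<noteq> j \<longrightarrow> x $ k = z $ k" by (simp add: z_def)
      moreover have "\<not> dep i j" using insert.prems(1) by simp
      ultimately show ?thesis unfolding dep_def by blast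
    qed
    also have "\<dots> = T y $ i"
      using insert by (intro insert.IH) (auto simp: z_def)
    finally show ?case .
  qed
  have "finite {k. \<not> dep i k}" by simp
  from *[OF this] assms show ?thesis by blast
qed

lemma eq_absorbing:
  assumes "absorbing D" "i \<in> D" "\<And>k. k \<in> D \<Longrightarrow> x $ k = y $ k"
  shows "T x $ i = T y $ i"
  using assms by (intro eq_off_independent) (auto simp: absorbing_def)

lemma mono_absorbing:
  assumes "absorbing D" "i \<in> D" "\<And>k. k \<in> D \<Longrightarrow> x $ k \<le> y $ k"
  shows "T x $ i \<le> T y $ i"
proof -
  define w where "w = (\<chi> k. if k \<in> D then x $ k else y $ k)"
  have "T x $ i = T w $ i"
    using assms by (intro eq_absorbing[of D]) (auto simp: w_def)
  also have "\<dots> \<le> T y $ i"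
    using assms by (intro mono_comp) (auto simp: w_def)
  finally show ?thesis .
qed

lemma absorbing_reach: "reach i j \<Longrightarrow> absorbing D \<Longrightarrow> i \<in> D \<Longrightarrow> j \<in> D"
  by (induction rule: rtranclp_induct) (auto simp: absorbing_def)

lemma absorbing_empty: "absorbing {}"
  by (simp add: absorbing_def)

lemma absorbing_UNIV: "absorbing UNIV"
  by (simp add: absorbing_def)

lemma scc_refl: "i \<in> scc i"
  by (simp add: scc_def)

lemma scc_reach: "j \<in> scc i \<Longrightarrow> k \<in> scc i \<Longrightarrow> reach j k"
  by (auto simp: scc_def intro: rtranclp_trans)

lemma scc_eq: "j \<in> scc i \<Longrightarrow> scc j = scc i"
  by (auto simp: scc_def intro: rtranclp_trans)

text \<open>A convex monotone function of one variable is either constant or unbounded, and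
  nonexpansiveness makes the alternative independent of the base point.\<close>

lemma dep_unbounded:
  assumes "dep i j"
  shows "\<exists>t0\<ge>0. \<forall>t\<ge>t0. T (x + t *\<^sub>R axis j 1) $ i \<ge> M"
proof -
  from assms obtain a b where ab: "\<forall>k. k \<noteq> j \<longrightarrow> a $ k = b $ k" "T a $ i < T b $ i"
    unfolding dep_def by (metis linorder_neqE_linordered_idom)
  define s where "s = b $ j - a $ j"
  have b: "b = a + s *\<^sub>R axis j 1"
    using ab(1) by (auto simp: vec_eq_iff axis_def s_def)
  have s: "s > 0"
  proof (rule ccontr)
    assume "\<not> s > 0"
    then have "T b $ i \<le> T a $ i"
      using ab(1) by (intro mono_comp) (metis diff_gt_0_iff_gt linorder_not_less order_refl s_def)
    with ab(2) show False by simp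
  qed
  define d where "d = T b $ i - T a $ i"
  have d: "d > 0" using ab(2) by (simp add: d_def)
  define g where "g t = T (a + t *\<^sub>R axis j 1) $ i" for t
  \<comment> \<open>\<open>b\<close> lies on the segment from \<open>a\<close> to the point at
    parameter \<open>t\<close>, so by convexity the mean slope up to \<open>t\<close> is at least
    the slope \<open>d / s\<close> up to \<open>b\<close>.\<close>
  have grow: "g t \<ge> T a $ i + (t / s) * d" if "t \<ge> s" for t
  proof -
    define u where "u = s / t"
    have u: "0 \<le> u" "u \<le> 1" and t: "t > 0" using s that by (auto simp: u_def)
    have "b = (1 - u) *\<^sub>R a + u *\<^sub>R (a + t *\<^sub>R axis j 1)"
      using t by (simp add: b u_def algebra_simps)
    then have "T b $ i \<le> (1 - u) * T a $ i + u * g t"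
      using convex_onD[OF convex[of i], of u a "a + t *\<^sub>R axis j 1"] u by (simp add: g_def)
    then have "d \<le> u * (g t - T a $ i)" by (simp add: d_def algebra_simps)
    then show ?thesis using s t by (simp add: u_def field_simps)
  qed
  \<comment> \<open>Growth must reach \<open>M\<close> after losing \<open>norm (a - x)\<close> in
    the change of base point from \<open>a\<close> to \<open>x\<close>.\<close>
  define t0 where "t0 = max s ((M + norm (a - x) - T a $ i) * s / d)"
  have "T (x + t *\<^sub>R axis j 1) $ i \<ge> M" if "t \<ge> t0" for t
  proof -
    have "g t \<le> T (x + t *\<^sub>R axis j 1) $ i + norm (a - x)"
      using nonexpansive[of "a + t *\<^sub>R axis j 1" i "x + t *\<^sub>R axis j 1"] by (simp add: g_def)
    moreover have "g t \<ge> T a $ i + (t / s) * d" using grow that by (simp add: t0_def)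
    moreover have "(t / s) * d \<ge> M + norm (a - x) - T a $ i"
    proof -
      have "(M + norm (a - x) - T a $ i) * s / d \<le> t" using that by (simp add: t0_def)
      then show ?thesis using s d by (simp add: field_simps)
    qed
    ultimately show ?thesis by simp
  qed
  moreover have "t0 \<ge> 0" using s by (simp add: t0_def)
  ultimately show ?thesis by blast
qed

text \<open>By monotonicity the threshold found at the base point 0 serves all nonnegative vectors
  at once; this uniformity is what later bounds need.\<close>

lemma dep_unbounded_nonneg:
  assumes "dep i j"
  obtains t where "t \<ge> 0" "\<And>z. (\<And>k. z $ k \<ge> 0) \<Longrightarrow> z $ j \<ge> t \<Longrightarrow> T z $ i \<ge> M"
proof -
  obtain t where t: "t \<ge> 0" "T (0 + t *\<^sub>R axis j 1) $ i \<ge> M"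
    using dep_unbounded[OF assms] by blast
  have "T z $ i \<ge> M" if "\<And>k. z $ k \<ge> 0" "z $ j \<ge> t" for z
  proof -
    have "T (0 + t *\<^sub>R axis j 1) $ i \<le> T z $ i"
      using that by (intro mono_comp) (auto simp: axis_def)
    with t show ?thesis by simp
  qed
  with t that show thesis by blast
qed

text \<open>Bounds travel along arcs: a large entry at the head makes \<open>T z\<close> large at
  the tail, where it is at most \<open>2 * z $ k + K\<close>. The factor 2 leaves room for
  discounted equations with discount at most 1/2; a nonnegative fixed point satisfies the inequality
  with \<open>K = 0\<close>.\<close>

lemma reach_bound:
  assumes "reach i j"
  shows "\<exists>B'. \<forall>z. (\<forall>k. z $ k \<ge> 0) \<longrightarrow> (\<forall>k. reach i k \<longrightarrow> T z $ k \<le> 2 * z $ k + K) \<longrightarrow> z $ i \<le> B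
    \<longrightarrow> z $ j \<le> B'"
  using assms
proof (induction rule: rtranclp_induct)
  case base
  then show ?case by blast
next
  case (step j k)
  then obtain B' where B': "\<forall>z. (\<forall>k. z $ k \<ge> 0) \<longrightarrow> (\<forall>k. reach i k \<longrightarrow> T z $ k \<le> 2 * z $ k + K)
     \<longrightarrow> z $ i \<le> B \<longrightarrow> z $ j \<le> B'" by blast
  obtain t where t: "\<And>z. (\<And>k. z $ k \<ge> 0) \<Longrightarrow> z $ k \<ge> t \<Longrightarrow> T z $ j \<ge> 2 * B' + K + 1"
    using dep_unbounded_nonneg[OF step(2)] by blast
  have "z $ k \<le> t" if "\<forall>k. z $ k \<ge> 0" "\<forall>k. reach i k \<longrightarrow> T z $ k \<le> 2 * z $ k + K" "z $ i \<le> B" for z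
  proof (rule ccontr)
    assume "\<not> z $ k \<le> t"
    then have "T z $ j \<ge> 2 * B' + K + 1" using t that by simp
    moreover have "T z $ j \<le> 2 * z $ j + K" "z $ j \<le> B'" using that step(1) B' by auto
    ultimately show False by simp
  qed
  then show ?case by blast
qed

section \<open>Solving the fixed point equation on part of the coordinates\<close>

text \<open>A Dirichlet problem: freezing the entries outside \<open>C\<close> at the values of
  \<open>u\<close> gives a map that is still monotone and continuous, with \<open>l\<close> and
  \<open>u\<close> as subsolution and supersolution.\<close>

lemma monotone_fixpoint_on:
  assumes lu: "l \<le> u" and off: "\<And>i. i \<notin> C \<Longrightarrow> l $ i = u $ i"
    and l: "\<And>i. i \<in> C \<Longrightarrow> l $ i \<le> T l $ i" and u: "\<And>i. i \<in> C \<Longrightarrow> T u $ i \<le> u $ i"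
  obtains z where "\<And>i. i \<in> C \<Longrightarrow> T z $ i = z $ i" "\<And>i. i \<notin> C \<Longrightarrow> z $ i = u $ i"
proof -
  define G where "G y = (\<chi> i. if i \<in> C then T y $ i else u $ i)" for y
  have "x \<le> y \<Longrightarrow> G x \<le> G y" for x y
    using mono[of x y] by (auto simp: G_def less_eq_vec_def)
  moreover have "continuous_on UNIV G"
    unfolding G_def
  proof (rule continuous_on_vec_lambda)
    fix i show "continuous_on UNIV (\<lambda>y. if i \<in> C then T y $ i else u $ i)"
      by (cases "i \<in> C") (auto intro: continuous_comp)
  qed
  moreover have "l \<le> G l" "G u \<le> u"
    using l u off by (auto simp: G_def less_eq_vec_def)
  ultimately have "\<exists>z. G z = z"
    using monotone_iteration[of G l u] lu by blast
  then obtain z where z: "G z = z" ..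
  have "(if i \<in> C then T z $ i else u $ i) = z $ i" for i
    using arg_cong[OF z, of "\<lambda>v. v $ i"] by (simp add: G_def)
  then show thesis using that[of z] by (metis (full_types))
qed

lemma discounted_fixpoint:
  assumes e: "0 < e" "e < 1"
  obtains x where "x = (1 - e) *\<^sub>R T x"
proof -
  \<comment> \<open>With \<open>norm (T 0) = e * c\<close> the product
    \<open>(1 - e) * (norm (T 0) + c)\<close> equals \<open>(1 - e * e) * c\<close>, so the constant
    vectors with entries -c and c enclose a fixed point.\<close>
  define c where "c = norm (T 0) / e"
  define G where "G x = (1 - e) *\<^sub>R T x" for x
  have G_mono: "x \<le> y \<Longrightarrow> G x \<le> G y" for x y
    using mono[of x y] e by (auto simp: G_def less_eq_vec_def intro: mult_left_mono)
  have G_cont: "continuous_on UNIV G"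
    unfolding G_def by (intro continuous_intros continuous)
  have c0: "0 \<le> c" and ec: "norm (T 0) = e * c" using e by (simp_all add: c_def)
  have "c - (1 - e) * (norm (T 0) + c) = e * e * c" by (simp add: ec algebra_simps)
  moreover have "0 \<le> e * e * c" using e c0 by simp
  ultimately have c: "(1 - e) * (norm (T 0) + c) \<le> c" by linarith
  have up: "T (0 + vec c) $ i \<le> norm (T 0) + c" and low: "- (norm (T 0) + c) \<le> T (0 - vec c) $ i" for i
    unfolding shift_comp shift_minus_comp using component_le_norm_cart[of "T 0" i] by linarith+
  have "(1 - e) * T (vec c) $ i \<le> c" for i
    using order_trans[OF mult_left_mono[OF up[of i], of "1 - e"] c] e by simp
  then have Gu: "G (vec c) \<le> vec c" by (simp add: G_def less_eq_vec_def)
  have "- c \<le> (1 - e) * T (- vec c) $ i" for i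
    using mult_left_mono[OF low[of i], of "1 - e"] c e by (simp add: algebra_simps)
  then have Gl: "- vec c \<le> G (- vec c)" by (simp add: G_def less_eq_vec_def)
  have "- vec c \<le> (vec c :: real^'n)" using c0 by (simp add: less_eq_vec_def)
  from monotone_iteration[OF G_mono G_cont Gl Gu this] obtain z where "G z = z" by blast
  then have "z = (1 - e) *\<^sub>R T z" by (simp add: G_def)
  then show thesis by (rule that)
qed

text \<open>Eigenvectors of the discounted maps, shifted so that their least entry on \<open>C\<close> vanishes,
  stay bounded because their least entry controls everything reachable from it.\<close>

lemma strongly_connected_eigenvector:
  assumes C: "absorbing C" "C \<noteq> {}" and conn: "\<And>i j. i \<in> C \<Longrightarrow> j \<in> C \<Longrightarrow> reach i j"
  obtains x \<mu> where "\<And>i. i \<in> C \<Longrightarrow> T x $ i = x $ i + \<mu>"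
proof -
  \<comment> \<open>From \<open>(1 - e) * T z $ i \<le> z $ i + norm (T 0)\<close> and
    \<open>e \<le> 1/2\<close> follows \<open>T z $ i \<le> 2 * z $ i + K\<close>.\<close>
  define K where "K = 2 * norm (T 0)"
  have "\<exists>B. \<forall>i\<in>C. \<forall>j\<in>C. \<forall>z. (\<forall>k. z $ k \<ge> 0) \<longrightarrow> (\<forall>k\<in>C. T z $ k \<le> 2 * z $ k + K)
    \<longrightarrow> z $ i \<le> 0 \<longrightarrow> z $ j \<le> B"
  proof -
    have "\<exists>B. \<forall>z. (\<forall>k. z $ k \<ge> 0) \<longrightarrow> (\<forall>k\<in>C. T z $ k \<le> 2 * z $ k + K)
      \<longrightarrow> z $ i \<le> 0 \<longrightarrow> z $ j \<le> B" if "i \<in> C" "j \<in> C" for i j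
      using reach_bound[OF conn[OF that], of K 0] absorbing_reach[OF _ C(1) that(1)] by blast
    then obtain b where b: "\<And>i j z. i \<in> C \<Longrightarrow> j \<in> C \<Longrightarrow> (\<forall>k. z $ k \<ge> 0) \<Longrightarrow>
        (\<forall>k\<in>C. T z $ k \<le> 2 * z $ k + K) \<Longrightarrow> z $ i \<le> 0 \<Longrightarrow> z $ j \<le> b i j"
      by metis
    have "b i j \<le> Max (range (\<lambda>(i, j). b i j))" for i j
      by (rule Max_ge) (auto intro: image_eqI[of _ _ "(i, j)"])
    then show ?thesis using b by (meson order_trans)
  qed
  then obtain B where B: "\<And>i j z. i \<in> C \<Longrightarrow> j \<in> C \<Longrightarrow> (\<forall>k. z $ k \<ge> 0) \<Longrightarrow>
      (\<forall>k\<in>C. T z $ k \<le> 2 * z $ k + K) \<Longrightarrow> z $ i \<le> 0 \<Longrightarrow> z $ j \<le> B"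
    by metis
  have ex: "\<exists>z m. (\<forall>i. 0 \<le> z $ i \<and> z $ i \<le> max B 0) \<and> \<bar>e * m\<bar> \<le> norm (T 0) \<and>
      (\<forall>i\<in>C. (1 - e) * T z $ i = z $ i + e * m)" if e: "0 < e" "e \<le> 1/2" for e
  proof -
    obtain x where x: "x = (1 - e) *\<^sub>R T x"
      using discounted_fixpoint[of e] e by auto
    have xi: "x $ i = (1 - e) * T x $ i" for i
      by (metis x vector_scaleR_component real_scaleR_def)
    obtain p where p: "p \<in> C" "\<And>i. i \<in> C \<Longrightarrow> x $ p \<le> x $ i"
    proof -
      have "finite ((\<lambda>i. x $ i) ` C)" "(\<lambda>i. x $ i) ` C \<noteq> {}" using C by auto
      then have "Min ((\<lambda>i. x $ i) ` C) \<in> (\<lambda>i. x $ i) ` C" by (rule Min_in)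
      then obtain p where "p \<in> C" "x $ p = Min ((\<lambda>i. x $ i) ` C)" by auto
      then show thesis using that by simp
    qed
    define m where "m = x $ p"
    \<comment> \<open>The entries off \<open>C\<close> do not influence \<open>T\<close> on
      \<open>C\<close>; setting them to 0 confines \<open>z\<close> to a compact box.\<close>
    define z where "z = (\<chi> i. if i \<in> C then x $ i - m else 0)"
    have z0: "\<forall>i. 0 \<le> z $ i" using p by (simp add: z_def m_def)
    \<comment> \<open>At an entry of largest modulus the discounted equation gives \<open>\<bar>x $
      q\<bar> \<le> (1 - e) * (norm (T 0) + \<bar>x $ q\<bar>)\<close>, hence a bound on
      \<open>e * \<bar>x $ q\<bar>\<close> that does not depend on \<open>e\<close>.\<close>
    obtain q where q: "\<And>i. \<bar>x $ i\<bar> \<le> \<bar>x $ q\<bar>"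
    proof -
      have "Max (range (\<lambda>i. \<bar>x $ i\<bar>)) \<in> range (\<lambda>i. \<bar>x $ i\<bar>)" by (rule Max_in) auto
      then obtain q where "Max (range (\<lambda>i. \<bar>x $ i\<bar>)) = \<bar>x $ q\<bar>" by (rule rangeE)
      moreover have "\<bar>x $ i\<bar> \<le> Max (range (\<lambda>i. \<bar>x $ i\<bar>))" for i by (rule Max_ge) auto
      ultimately show thesis using that[of q] by simp
    qed
    have em: "\<bar>e * m\<bar> \<le> norm (T 0)"
    proof -
      have "x $ k \<le> (0 + vec \<bar>x $ q\<bar>) $ k" "(0 - vec \<bar>x $ q\<bar>) $ k \<le> x $ k" for k
        using q[of k] by (simp_all add: abs_le_iff)
      then have "T x $ q \<le> T (0 + vec \<bar>x $ q\<bar>) $ q" "T (0 - vec \<bar>x $ q\<bar>) $ q \<le> T x $ q"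
        by (intro mono_comp; blast)+
      then have "\<bar>T x $ q\<bar> \<le> norm (T 0) + \<bar>x $ q\<bar>"
        unfolding shift_comp shift_minus_comp using component_le_norm_cart[of "T 0" q] by linarith
      then have "(1 - e) * \<bar>T x $ q\<bar> \<le> (1 - e) * (norm (T 0) + \<bar>x $ q\<bar>)"
        using e by (intro mult_left_mono) auto
      moreover have "\<bar>x $ q\<bar> = (1 - e) * \<bar>T x $ q\<bar>"
        using e by (subst xi) (simp add: abs_mult)
      ultimately have "\<bar>x $ q\<bar> \<le> (1 - e) * (norm (T 0) + \<bar>x $ q\<bar>)" by simp
      then have "e * \<bar>x $ q\<bar> \<le> (1 - e) * norm (T 0)" by (simp add: algebra_simps)
      also have "\<dots> \<le> norm (T 0)" using e by (simp add: mult_left_le_one_le)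
      finally have "e * \<bar>x $ q\<bar> \<le> norm (T 0)" .
      moreover have "e * \<bar>m\<bar> \<le> e * \<bar>x $ q\<bar>"
        using q e unfolding m_def by (intro mult_left_mono) auto
      moreover have "\<bar>e * m\<bar> = e * \<bar>m\<bar>" using e by (simp add: abs_mult)
      ultimately show ?thesis by linarith
    qed
    have eq: "(1 - e) * T z $ i = z $ i + e * m" if "i \<in> C" for i
    proof -
      have "T z $ i = T (x - vec m) $ i"
        using that by (intro eq_absorbing[OF C(1)]) (auto simp: z_def)
      then have "(1 - e) * T z $ i = x $ i - (1 - e) * m"
        by (subst xi) (simp add: shift_minus_comp right_diff_distrib)
      then show ?thesis using that by (simp add: z_def algebra_simps)
    qed
    have "T z $ i \<le> 2 * z $ i + K" if "i \<in> C" for i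
    proof -
      have "(1 - e) * T z $ i \<le> z $ i + norm (T 0)" using eq[OF that] em by linarith
      also have "\<dots> \<le> (1 - e) * (2 * (z $ i + norm (T 0)))"
      proof -
        have "0 \<le> (1 - 2 * e) * (z $ i + norm (T 0))" using e z0 by simp
        then show ?thesis by (simp add: algebra_simps)
      qed
      finally have "T z $ i \<le> 2 * (z $ i + norm (T 0))" using e by (simp add: mult_le_cancel_left)
      then show ?thesis by (simp add: K_def)
    qed
    moreover have "z $ p \<le> 0" by (simp add: z_def m_def)
    ultimately have "z $ j \<le> B" if "j \<in> C" for j using B p(1) that z0 by blast
    then have "z $ j \<le> max B 0" for j by (cases "j \<in> C") (auto simp: z_def le_max_iff_disj)
    then show ?thesis using z0 em eq by blast
  qed
  \<comment> \<open>The offset 2 keeps the discount at most 1/2 already for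
    \<open>k = 0\<close>.\<close>
  define \<epsilon> where "\<epsilon> k = 1 / real (k + 2)" for k
  have "\<forall>k. \<exists>z m. (\<forall>i. 0 \<le> z $ i \<and> z $ i \<le> max B 0) \<and> \<bar>\<epsilon> k * m\<bar> \<le> norm (T 0) \<and>
      (\<forall>i\<in>C. (1 - \<epsilon> k) * T z $ i = z $ i + \<epsilon> k * m)"
  proof
    fix k show "\<exists>z m. (\<forall>i. 0 \<le> z $ i \<and> z $ i \<le> max B 0) \<and> \<bar>\<epsilon> k * m\<bar> \<le> norm (T 0) \<and>
      (\<forall>i\<in>C. (1 - \<epsilon> k) * T z $ i = z $ i + \<epsilon> k * m)"
      by (rule ex) (simp_all add: \<epsilon>_def field_simps)
  qed
  then obtain Z M where ZM: "\<And>k i. 0 \<le> Z k $ i \<and> Z k $ i \<le> max B 0"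
    "\<And>k. \<bar>\<epsilon> k * M k\<bar> \<le> norm (T 0)"
    "\<And>k i. i \<in> C \<Longrightarrow> (1 - \<epsilon> k) * T (Z k) $ i = Z k $ i + \<epsilon> k * M k"
    by metis
  \<comment> \<open>Vector and discount remainder converge along a common subsequence; the limit of
    the remainders is the eigenvalue.\<close>
  have "compact (cbox 0 (vec (max B 0) :: real^'n) \<times> cbox (- norm (T 0)) (norm (T 0)))"
    by (intro compact_Times compact_cbox)
  moreover have "\<forall>k. (Z k, \<epsilon> k * M k) \<in> cbox 0 (vec (max B 0)) \<times> cbox (- norm (T 0)) (norm (T 0))"
    using ZM(1,2) by (auto simp: mem_box_cart abs_le_iff minus_le_iff)
  ultimately obtain l r where lr: "strict_mono (r :: nat \<Rightarrow> nat)"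
      "((\<lambda>k. (Z k, \<epsilon> k * M k)) \<circ> r) \<longlonglongrightarrow> l"
    unfolding compact_def by meson
  obtain z \<mu> where l: "l = (z, \<mu>)" by (cases l)
  have zlim: "(\<lambda>k. Z (r k)) \<longlonglongrightarrow> z" and \<mu>lim: "(\<lambda>k. \<epsilon> (r k) * M (r k)) \<longlonglongrightarrow> \<mu>"
    using tendsto_fst[OF lr(2)] tendsto_snd[OF lr(2)] by (auto simp: l o_def)
  have "\<epsilon> \<longlonglongrightarrow> 0"
    unfolding \<epsilon>_def using LIMSEQ_ignore_initial_segment[OF lim_1_over_n, of 2] by simp
  then have \<epsilon>lim: "(\<lambda>k. \<epsilon> (r k)) \<longlonglongrightarrow> 0"
    using LIMSEQ_subseq_LIMSEQ[OF _ lr(1)] by (auto simp: o_def)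
  have "T z $ i = z $ i + \<mu>" if "i \<in> C" for i
  proof -
    have "(\<lambda>k. T (Z (r k)) $ i) \<longlonglongrightarrow> T z $ i"
      using continuous_on_tendsto_compose[OF continuous_comp[of i] zlim] by simp
    then have "(\<lambda>k. (1 - \<epsilon> (r k)) * T (Z (r k)) $ i) \<longlonglongrightarrow> (1 - 0) * T z $ i"
      by (rule tendsto_mult[OF tendsto_diff[OF tendsto_const \<epsilon>lim]])
    moreover have "(\<lambda>k. Z (r k) $ i + \<epsilon> (r k) * M (r k)) \<longlonglongrightarrow> z $ i + \<mu>"
      by (intro tendsto_intros zlim \<mu>lim)
    ultimately show ?thesis using ZM(3)[OF that] LIMSEQ_unique by fastforce
  qed
  then show thesis using that by blast
qed

text \<open>A supersolution on \<open>C\<close> is a shift of \<open>v\<close>. For a subsolution the values on \<open>C\<close> are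
  raised successively along arcs leading out of \<open>C\<close>, starting from a large value outside.\<close>

lemma extend_fixpoint:
  assumes out: "\<And>i. i \<in> C \<Longrightarrow> \<exists>j. j \<notin> C \<and> reach i j"
    and v: "\<And>i. i \<in> C \<Longrightarrow> T v $ i \<le> v $ i"
  obtains y where "\<And>i. i \<notin> C \<Longrightarrow> y $ i = x $ i" "\<And>i. i \<in> C \<Longrightarrow> T y $ i = y $ i"
proof -
  \<comment> \<open>\<open>S\<close> collects the entries raised so far. Outside \<open>C\<close>
    the vector is \<open>x\<close> up to the shift \<open>s\<close>, and on the raised part of
    \<open>C\<close> it is a subsolution. \<open>P\<close> demands this for every height
    \<open>M\<close>, because raising the tail of an arc to \<open>M\<close> needs a height at its
    head that depends on the arc.\<close>
  define Q where "Q S M z s \<longleftrightarrow> (\<forall>i. z $ i \<ge> 0) \<and> (\<forall>i\<in>S. z $ i \<ge> M) \<and>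
    (\<forall>i. i \<notin> S \<longrightarrow> z $ i = 0) \<and> (\<forall>i. i \<notin> C \<longrightarrow> z $ i = x $ i + s) \<and>
    (\<forall>i. i \<in> S \<longrightarrow> i \<in> C \<longrightarrow> z $ i \<le> T z $ i)" for S M z s
  define P where "P S \<longleftrightarrow> - C \<subseteq> S \<and> (\<forall>M\<ge>0. \<exists>z s. Q S M z s)" for S
  have "P (- C)"
    unfolding P_def
  proof (intro conjI allI impI)
    fix M :: real assume M: "M \<ge> 0"
    have "0 \<le> x $ i + norm x" for i
      using component_le_norm_cart[of x i] by (simp add: abs_le_iff)
    then have "M \<le> x $ i + (norm x + M)" for i by (simp add: add.assoc[symmetric])
    moreover from this have "0 \<le> x $ i + (norm x + M)" for i using M order_trans by blast
    ultimately have "Q (- C) M (\<chi> i. if i \<in> C then 0 else x $ i + (norm x + M)) (norm x + M)"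
      by (simp add: Q_def)
    then show "\<exists>z s. Q (- C) M z s" by blast
  qed simp
  moreover have "\<exists>S'. S \<subset> S' \<and> P S'" if S: "P S" "S \<noteq> UNIV" for S
  proof -
    from S(1) have CS: "- C \<subseteq> S" and ex: "\<And>M. M \<ge> 0 \<Longrightarrow> \<exists>z s. Q S M z s"
      unfolding P_def by simp_all
    obtain i where i: "i \<notin> S" using S(2) by auto
    then have "i \<in> C" using CS by auto
    then obtain j where j: "j \<notin> C" "reach i j" using out by blast
    then have "j \<in> S" using CS by auto
    with i j obtain a b where ab: "a \<notin> S" "b \<in> S" "dep a b"
      using rtranclp_crossing[of dep i j S] by blast
    have "\<exists>z s. Q (insert a S) M z s" if M: "M \<ge> 0" for M
    proof -
      obtain t where t: "t \<ge> 0" "\<And>z. (\<And>k. z $ k \<ge> 0) \<Longrightarrow> z $ b \<ge> t \<Longrightarrow> T z $ a \<ge> M"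
        using dep_unbounded_nonneg[OF ab(3)] by blast
      have "max M t \<ge> 0" using M by simp
      from ex[OF this] obtain z s where "Q S (max M t) z s" by blast
      then have z: "\<And>i. z $ i \<ge> 0" "\<And>i. i \<in> S \<Longrightarrow> max M t \<le> z $ i" "\<And>i. i \<notin> S \<Longrightarrow> z $ i = 0"
        "\<And>i. i \<notin> C \<Longrightarrow> z $ i = x $ i + s" "\<And>i. i \<in> S \<Longrightarrow> i \<in> C \<Longrightarrow> z $ i \<le> T z $ i"
        unfolding Q_def by blast+
      define w where "w = (\<chi> i. if i = a then M else z $ i)"
      have wz: "z $ i \<le> w $ i" for i using z(3)[OF ab(1)] M by (simp add: w_def)
      have w0: "0 \<le> w $ i" for i using z(1) wz by (rule order_trans)
      have "w $ i \<le> T w $ i" if "i \<in> insert a S" "i \<in> C" for i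
      proof (cases "i = a")
        case True
        have "t \<le> z $ b" using z(2)[OF ab(2)] by simp
        then have "M \<le> T w $ a" using wz by (intro t(2) w0) (rule order_trans)
        with True show ?thesis by (simp add: w_def)
      next
        case False
        then have "w $ i \<le> T z $ i" using that z(5) by (simp add: w_def)
        also have "\<dots> \<le> T w $ i" using wz by (rule mono_comp)
        finally show ?thesis .
      qed
      moreover have "w $ i = x $ i + s" if "i \<notin> C" for i
        using z(4)[OF that] that ab(1) CS by (auto simp: w_def)
      moreover have "M \<le> w $ i" if "i \<in> insert a S" for i
        using z(2)[of i] that by (auto simp: w_def)
      moreover have "w $ i = 0" if "i \<notin> insert a S" for i
        using z(3)[of i] that by (simp add: w_def)
      ultimately have "Q (insert a S) M w s" using w0 unfolding Q_def by blast
      then show ?thesis by blast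
    qed
    then have "P (insert a S)" using CS unfolding P_def by blast
    then show ?thesis using ab(1) by blast
  qed
  ultimately have "P UNIV" by (rule finite_growth_induct)
  then have "\<exists>z s. Q UNIV 0 z s" unfolding P_def by simp
  then obtain z s where "Q UNIV 0 z s" by blast
  then have z: "\<And>i. i \<notin> C \<Longrightarrow> z $ i = x $ i + s" "\<And>i. i \<in> C \<Longrightarrow> z $ i \<le> T z $ i"
    unfolding Q_def by simp_all
  \<comment> \<open>Shifting back restores the prescribed values of \<open>x\<close> outside
    \<open>C\<close>; \<open>t\<close> is then large enough for \<open>v + vec t\<close> to dominate
    both \<open>l\<close> and \<open>x\<close>.\<close>
  define l where "l = z - vec s"
  define t where "t = norm (x - v) + norm (l - v)"
  define u where "u = (\<chi> i. if i \<in> C then v $ i + t else x $ i)"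
  have lv: "l $ i \<le> v $ i + t" and xv: "x $ i \<le> v $ i + t" for i
    using component_le_norm_cart[of "l - v" i] component_le_norm_cart[of "x - v" i]
      norm_ge_zero[of "x - v"] norm_ge_zero[of "l - v"]
    by (auto simp: t_def abs_le_iff simp del: norm_ge_zero)
  have lx: "l $ i = x $ i" if "i \<notin> C" for i using z(1) that by (simp add: l_def)
  show thesis
  proof (rule monotone_fixpoint_on)
    show "l \<le> u" using lv lx by (simp add: less_eq_vec_def u_def)
    show "l $ i = u $ i" if "i \<notin> C" for i using lx that by (simp add: u_def)
    show "l $ i \<le> T l $ i" if "i \<in> C" for i
      using z(2) that by (simp add: l_def shift_minus_comp)
    show "T u $ i \<le> u $ i" if "i \<in> C" for i
    proof -
      have "T u $ i \<le> T (v + vec t) $ i"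
        using xv by (intro mono_comp) (simp add: u_def)
      then show ?thesis using v[OF that] that by (simp add: shift_comp u_def)
    qed
  next
    fix y assume "\<And>i. i \<in> C \<Longrightarrow> T y $ i = y $ i" "\<And>i. i \<notin> C \<Longrightarrow> y $ i = u $ i"
    then show thesis using that[of y] by (simp add: u_def)
  qed
qed

subsection \<open>Fixed points and strongly connected components\<close>

text \<open>Among the vertices outside \<open>D\<close> take one that reaches the fewest vertices
  outside \<open>D\<close>. Whatever it reaches outside \<open>D\<close> reaches the same vertices
  there, hence reaches it back.\<close>

lemma next_class:
  assumes D: "absorbing D" "D \<noteq> UNIV"
  obtains i where "scc i \<inter> D = {}" "absorbing (scc i \<union> D)"
proof -
  define N where "N i = card ({j. reach i j} - D)" for i
  obtain i where i: "i \<notin> D" "\<And>j. j \<notin> D \<Longrightarrow> N i \<le> N j"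
    using D(2) ex_has_least_nat[of "\<lambda>i. i \<notin> D" _ N] by blast
  have "reach j i" if j: "reach i j" "j \<notin> D" for j
  proof -
    have "{k. reach j k} - D \<subseteq> {k. reach i k} - D" using j by auto
    then have "{k. reach j k} - D = {k. reach i k} - D"
      using i(2)[OF j(2)] unfolding N_def by (intro card_seteq) auto
    then show ?thesis using i(1) by blast
  qed
  then have eq: "scc i \<union> D = {j. reach i j} \<union> D" by (auto simp: scc_def)
  have "absorbing (scc i \<union> D)"
    unfolding eq using D(1) by (auto simp: absorbing_def intro: rtranclp.rtrancl_into_rtrancl)
  moreover have "scc i \<inter> D = {}"
    using absorbing_reach[OF _ D(1)] i(1) by (auto simp: scc_def)
  ultimately show thesis using that by blast
qed

text \<open>Minimality again: among the vertices reachable from \<open>i\<close>, one with the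
  smallest reachable set lies in a final class.\<close>

lemma reach_absorbing_class:
  obtains j where "reach i j" "absorbing (scc j)"
proof -
  define N where "N j = card {k. reach j k}" for j
  obtain j where j: "reach i j" "\<And>k. reach i k \<Longrightarrow> N j \<le> N k"
    using ex_has_least_nat[of "reach i" i N] by blast
  have "reach k j" if "reach j k" for k
  proof -
    have "{l. reach k l} \<subseteq> {l. reach j l}" using that by auto
    moreover have "card {l. reach j l} \<le> card {l. reach k l}"
      using j(2)[of k] rtranclp_trans[OF j(1) that] by (simp add: N_def)
    ultimately have "{l. reach k l} = {l. reach j l}" by (intro card_seteq) auto
    then show ?thesis by blast
  qed
  then have "scc j = {k. reach j k}" by (auto simp: scc_def)
  then have "absorbing (scc j)"
    by (auto simp: absorbing_def intro: rtranclp.rtrancl_into_rtrancl)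
  with j that show thesis by blast
qed

lemma class_reaches_outside:
  assumes "\<not> absorbing (scc i)" "a \<in> scc i"
  shows "\<exists>j. j \<notin> scc i \<and> reach a j"
  using assms scc_reach unfolding absorbing_def by (meson rtranclp.rtrancl_into_rtrancl)

lemma fixpoint_exists:
  assumes final: "\<And>i. absorbing (scc i) \<Longrightarrow> \<exists>x. \<forall>k\<in>scc i. T x $ k = x $ k"
    and nonfinal: "\<And>i. \<not> absorbing (scc i) \<Longrightarrow> \<exists>v. \<forall>k\<in>scc i. T v $ k < v $ k"
  shows "\<exists>x. T x = x"
proof -
  define P where "P D \<longleftrightarrow> absorbing D \<and> (\<exists>x. \<forall>k\<in>D. T x $ k = x $ k)" for D
  have "P {}" by (simp add: P_def absorbing_empty)
  moreover have "\<exists>D'. D \<subset> D' \<and> P D'" if D: "P D" "D \<noteq> UNIV" for D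
  proof -
    from D have D_abs: "absorbing D" by (simp add: P_def)
    obtain x where x: "\<And>k. k \<in> D \<Longrightarrow> T x $ k = x $ k" using D(1) by (auto simp: P_def)
    obtain i where i: "scc i \<inter> D = {}" "absorbing (scc i \<union> D)"
      using next_class D_abs D(2) by blast
    have "\<exists>y. \<forall>k. (k \<in> D \<longrightarrow> y $ k = x $ k) \<and> (k \<in> scc i \<longrightarrow> T y $ k = y $ k)"
    \<comment> \<open>A final class ignores \<open>D\<close>, so its own fixed point is placed
      beside \<open>x\<close>. In both cases the values on \<open>D\<close> are kept, and the
      equations solved there survive because \<open>D\<close> is absorbing.\<close>
    proof (cases "absorbing (scc i)")
      case True
      then obtain w where w: "\<forall>k\<in>scc i. T w $ k = w $ k" using final by blast
      define y where "y = (\<chi> k. if k \<in> scc i then w $ k else x $ k)"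
      have "T y $ k = y $ k" if "k \<in> scc i" for k
        using eq_absorbing[OF True that, of y w] w that by (simp add: y_def)
      moreover have "y $ k = x $ k" if "k \<in> D" for k using that i(1) by (auto simp: y_def)
      ultimately show ?thesis by blast
    next
      case False
      then obtain v where v: "\<forall>k\<in>scc i. T v $ k < v $ k" using nonfinal by blast
      have "\<And>k. k \<in> scc i \<Longrightarrow> T v $ k \<le> v $ k" using v by (simp add: less_imp_le)
      then obtain y where "\<And>k. k \<notin> scc i \<Longrightarrow> y $ k = x $ k" "\<And>k. k \<in> scc i \<Longrightarrow> T y $ k = y $ k"
        using extend_fixpoint[of "scc i" v x] class_reaches_outside[OF False] by blast
      with i(1) show ?thesis by blast
    qed
    then obtain y where y: "\<And>k. k \<in> D \<Longrightarrow> y $ k = x $ k" "\<And>k. k \<in> scc i \<Longrightarrow> T y $ k = y $ k"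
      by blast
    have "T y $ k = y $ k" if "k \<in> D" for k
      using eq_absorbing[OF D_abs that, of y x] y(1) x that by simp
    then have "P (scc i \<union> D)" using i(2) y(2) by (auto simp: P_def)
    moreover have "D \<subset> scc i \<union> D" using i(1) scc_refl by blast
    ultimately show ?thesis by blast
  qed
  ultimately have "P UNIV" by (rule finite_growth_induct)
  then show ?thesis by (auto simp: P_def vec_eq_iff)
qed

text \<open>Shift a fixed point so that its least entry is 0. The position of that entry reaches
  \<open>c\<close>, so \<open>reach_bound\<close> limits how far the entry at \<open>c\<close> lies
  above the minimum.\<close>

lemma fixpoint_lower_bound:
  assumes "\<And>i. reach i c"
  obtains L where "\<And>z i. T z = z \<Longrightarrow> z $ c - L \<le> z $ i"
proof -
  have "\<exists>b. \<forall>z. (\<forall>k. z $ k \<ge> 0) \<longrightarrow> T z = z \<longrightarrow> z $ i \<le> 0 \<longrightarrow> z $ c \<le> b" for i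
    using reach_bound[OF assms[of i], of 0 0] by fastforce
  then obtain b where b: "\<And>i z. (\<forall>k. z $ k \<ge> 0) \<Longrightarrow> T z = z \<Longrightarrow> z $ i \<le> 0 \<Longrightarrow> z $ c \<le> b i"
    by metis
  have "z $ c - Max (range b) \<le> z $ i" if z: "T z = z" for z i
  proof -
    obtain p where p: "\<And>k. z $ p \<le> z $ k"
    proof -
      have "Min (range (\<lambda>k. z $ k)) \<in> range (\<lambda>k. z $ k)" by (rule Min_in) auto
      then obtain p where "Min (range (\<lambda>k. z $ k)) = z $ p" by (rule rangeE)
      moreover have "Min (range (\<lambda>k. z $ k)) \<le> z $ k" for k by (rule Min_le) auto
      ultimately show thesis using that[of p] by simp
    qed
    have "T (z - vec (z $ p)) = z - vec (z $ p)"
      by (simp add: vec_eq_iff shift_minus_comp z)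
    then have "(z - vec (z $ p)) $ c \<le> b p" using b[of "z - vec (z $ p)" p] p by simp
    also have "b p \<le> Max (range b)" by (rule Max_ge) auto
    finally show ?thesis using p[of i] by simp
  qed
  then show thesis using that by blast
qed

text \<open>Every vertex reaches the only final class, which gives the lower bounds. Upper bounds
  hold on that class by \<open>reach_bound\<close> and pass to each further class by comparison with
  its strict supersolution.\<close>

lemma fixpoints_bounded:
  assumes unique: "\<And>i. absorbing (scc i) \<Longrightarrow> scc i = scc c" and c: "absorbing (scc c)"
    and nonfinal: "\<And>i. \<not> absorbing (scc i) \<Longrightarrow> \<exists>v. \<forall>k\<in>scc i. T v $ k < v $ k"
  shows "\<exists>B. \<forall>z. T z = z \<longrightarrow> (\<forall>i. \<bar>z $ i - z $ c\<bar> \<le> B)"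
proof -
  have "reach i c" for i
    using reach_absorbing_class[of i] unique scc_refl scc_reach by (metis rtranclp_trans)
  then obtain L where L: "\<And>z i. T z = z \<Longrightarrow> z $ c - L \<le> z $ i"
    using fixpoint_lower_bound by blast
  define P where "P D \<longleftrightarrow> absorbing D \<and> scc c \<subseteq> D \<and>
    (\<exists>B. \<forall>z. T z = z \<longrightarrow> z $ c = 0 \<longrightarrow> (\<forall>i\<in>D. z $ i \<le> B))" for D
  have "P (scc c)"
  proof -
    have "\<exists>b. \<forall>z. T z = z \<longrightarrow> z $ c = 0 \<longrightarrow> z $ i \<le> b" if "i \<in> scc c" for i
    proof -
      have "reach c i" using that by (simp add: scc_def)
      then obtain b where b: "\<And>z. (\<forall>k. z $ k \<ge> 0) \<Longrightarrow> T z = z \<Longrightarrow> z $ c \<le> L \<Longrightarrow> z $ i \<le> b"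
        using reach_bound[of c i 0 L] by fastforce
      have "z $ i \<le> b - L" if z: "T z = z" "z $ c = 0" for z
      proof -
        have "T (z + vec L) = z + vec L" by (simp add: shift z)
        moreover have "\<forall>k. (z + vec L) $ k \<ge> 0"
        proof
          fix k show "(z + vec L) $ k \<ge> 0" using L[OF z(1), of k] z(2) by simp
        qed
        ultimately have "(z + vec L) $ i \<le> b" by (intro b) (auto simp: z)
        then show ?thesis by simp
      qed
      then show ?thesis by blast
    qed
    then obtain b where b: "\<And>i z. i \<in> scc c \<Longrightarrow> T z = z \<Longrightarrow> z $ c = 0 \<Longrightarrow> z $ i \<le> b i" by metis
    have "z $ i \<le> Max (range b)" if "i \<in> scc c" "T z = z" "z $ c = 0" for i z
    proof -
      have "b i \<le> Max (range b)" by (rule Max_ge) auto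
      with b[OF that] show ?thesis by (rule order_trans)
    qed
    then show ?thesis using c by (auto simp: P_def)
  qed
  moreover have "\<exists>D'. D \<subset> D' \<and> P D'" if D: "P D" "D \<noteq> UNIV" for D
  proof -
    from D have D_abs: "absorbing D" "scc c \<subseteq> D" by (simp_all add: P_def)
    obtain B where B: "\<And>z k. T z = z \<Longrightarrow> z $ c = 0 \<Longrightarrow> k \<in> D \<Longrightarrow> z $ k \<le> B"
      using D(1) by (auto simp: P_def)
    obtain i where i: "scc i \<inter> D = {}" "absorbing (scc i \<union> D)"
      using next_class D_abs D(2) by blast
    have "\<not> absorbing (scc i)" using unique[of i] i(1) D_abs(2) scc_refl by blast
    then obtain v where v: "\<And>k. k \<in> scc i \<Longrightarrow> T v $ k < v $ k" using nonfinal by blast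
    have "z $ k \<le> B + 2 * norm v" if z: "T z = z" "z $ c = 0" and k: "k \<in> scc i \<union> D" for z k
    proof (cases "k \<in> D")
      case True
      then have "z $ k \<le> B" by (rule B[OF z])
      then show ?thesis using norm_ge_zero[of v] by linarith
    next
      case False
      then have k: "k \<in> scc i" using k by simp
      \<comment> \<open>The least shift with \<open>z\<close> below \<open>v + vec s\<close> on the
        class, with contact at \<open>p\<close>. If \<open>s\<close> exceeded
        \<open>B + norm v\<close>, the comparison would also hold on \<open>D\<close>, and
        strictness of \<open>v\<close> at \<open>p\<close> would contradict the contact.\<close>
      define s where "s = Max ((\<lambda>k. z $ k - v $ k) ` scc i)"
      have s: "z $ k - v $ k \<le> s" if "k \<in> scc i" for k
        using that by (auto simp: s_def)
      have "s \<in> (\<lambda>k. z $ k - v $ k) ` scc i"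
        unfolding s_def using k by (intro Max_in) auto
      then obtain p where p: "p \<in> scc i" "s = z $ p - v $ p" by auto
      have "s \<le> B + norm v"
      proof (rule ccontr)
        assume "\<not> s \<le> B + norm v"
        have "z $ k \<le> (v + vec s) $ k" if "k \<in> scc i \<union> D" for k
          using that s[of k] B[OF z, of k] \<open>\<not> s \<le> B + norm v\<close> component_le_norm_cart[of v k]
          by (auto simp: abs_le_iff)
        then have "T z $ p \<le> T (v + vec s) $ p"
          using p(1) by (intro mono_absorbing[OF i(2)]) auto
        then show False using v[OF p(1)] p(2) z(1) by (simp add: shift_comp)
      qed
      then show ?thesis
        using s[OF k] component_le_norm_cart[of v k] by (simp add: abs_le_iff)
    qed
    then have "P (scc i \<union> D)" using i(2) D_abs(2) by (auto simp: P_def)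
    moreover have "D \<subset> scc i \<union> D" using i(1) scc_refl by blast
    ultimately show ?thesis by blast
  qed
  ultimately have "P UNIV" by (rule finite_growth_induct)
  then obtain B where B: "\<And>z k. T z = z \<Longrightarrow> z $ c = 0 \<Longrightarrow> z $ k \<le> B" by (auto simp: P_def)
  have "\<bar>z $ i - z $ c\<bar> \<le> max B L" if z: "T z = z" for z i
  proof -
    have "T (z - vec (z $ c)) = z - vec (z $ c)"
      by (simp add: vec_eq_iff shift_minus_comp z)
    then have "z $ i - z $ c \<le> B" using B[of "z - vec (z $ c)" i] by simp
    then show ?thesis using L[OF z, of i] by (auto simp: abs_le_iff le_max_iff_disj)
  qed
  then show ?thesis by blast
qed

section \<open>What a fixed point reveals about the classes\<close>

lemma final_class_unique:
  assumes x: "T x = x" and R: "\<And>z k l. T z = z \<Longrightarrow> (x $ k - z $ k) - (x $ l - z $ l) \<le> R"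
    and i: "absorbing (scc i)" and j: "absorbing (scc j)"
  shows "scc i = scc j"
proof (rule ccontr)
  assume ne: "scc i \<noteq> scc j"
  have disj: "scc i \<inter> scc j = {}"
  proof (rule ccontr)
    assume "scc i \<inter> scc j \<noteq> {}"
    then obtain k where "k \<in> scc i" "k \<in> scc j" by blast
    then show False using scc_eq[of k i] scc_eq[of k j] ne by simp
  qed
  \<comment> \<open>Both \<open>y\<close> and \<open>u\<close> differ from \<open>x\<close> by 0 or
    \<open>s\<close>, constantly on each of the two final classes. A fixed point between them is
    raised by at least \<open>s\<close> at \<open>i\<close> and not at all at \<open>j\<close>,
    which exceeds the allowed spread \<open>R\<close>.\<close>
  define s where "s = \<bar>R\<bar> + 1"
  define y where "y = (\<chi> k. if k \<in> scc i then x $ k + s else x $ k)"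
  define u where "u = (\<chi> k. if k \<in> scc j then x $ k else x $ k + s)"
  have s: "s > 0" by (simp add: s_def)
  have xk: "T x $ k = x $ k" for k by (simp add: x)
  have yu: "y \<le> u" using s disj by (auto simp: less_eq_vec_def y_def u_def)
  have "y $ k \<le> T y $ k" for k
  proof (cases "k \<in> scc i")
    case True
    then have "T y $ k = T (x + vec s) $ k"
      by (intro eq_absorbing[OF i]) (auto simp: y_def)
    with True show ?thesis by (simp add: shift_comp xk y_def)
  next
    case False
    have "T x $ k \<le> T y $ k" using s by (intro mono_comp) (simp add: y_def)
    with False show ?thesis by (simp add: xk y_def)
  qed
  moreover have "T u $ k \<le> u $ k" for k
  proof (cases "k \<in> scc j")
    case True
    then have "T u $ k = T x $ k"
      by (intro eq_absorbing[OF j]) (auto simp: u_def)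
    with True show ?thesis by (simp add: xk u_def)
  next
    case False
    have "T u $ k \<le> T (x + vec s) $ k" using s by (intro mono_comp) (simp add: u_def)
    with False show ?thesis by (simp add: shift_comp xk u_def)
  qed
  ultimately have "y \<le> T y" "T u \<le> u" by (auto simp: less_eq_vec_def)
  from monotone_iteration[OF mono continuous this yu]
  obtain z where z: "T z = z" "y \<le> z" "z \<le> u" by blast
  have "y $ i \<le> z $ i" "z $ j \<le> u $ j" using z(2,3) by (simp_all add: less_eq_vec_def)
  then have "x $ i + s \<le> z $ i" "z $ j \<le> x $ j" using scc_refl by (simp_all add: y_def u_def)
  then show False using R[OF z(1), of j i] by (simp add: s_def)
qed

text \<open>Lowering a fixed point on everything that does not reach the class and iterating gives
  fixed points again. If these stay at bounded distance, the class must be pulled down as well,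
  and the average of sufficiently many iterates is strictly decreased by convexity.\<close>

lemma nonfinal_class_strict_if_bounded:
  assumes x: "T x = x" and R: "\<And>z k l. T z = z \<Longrightarrow> (x $ k - z $ k) - (x $ l - z $ l) \<le> R"
    and i: "\<not> absorbing (scc i)"
  shows "\<exists>v. \<forall>k\<in>scc i. T v $ k < v $ k"
proof -
  define A where "A = {k. reach k i}"
  \<comment> \<open>The head of an arc leaving the class does not reach back, so \<open>d\<close> is
    among the entries that get lowered.\<close>
  obtain a d where ad: "a \<in> scc i" "dep a d" "d \<notin> scc i"
    using i by (auto simp: absorbing_def)
  have d: "d \<notin> A"
  proof
    assume "d \<in> A"
    then have "reach d i" by (simp add: A_def)
    moreover have "reach i d" using ad by (auto simp: scc_def intro: rtranclp.rtrancl_into_rtrancl)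
    ultimately show False using ad(3) by (simp add: scc_def)
  qed
  have abs: "absorbing (- A)"
    by (auto simp: absorbing_def A_def intro: converse_rtranclp_into_rtranclp)
  \<comment> \<open>The limit lies at least \<open>s\<close> below \<open>x\<close> at
    \<open>d\<close>, hence at least 2 below \<open>x\<close> everywhere; late iterates then lie
    more than 1 below.\<close>
  define s where "s = \<bar>R\<bar> + 2"
  define u where "u = (\<chi> k. if k \<in> A then x $ k else x $ k - s)"
  have s: "s > 0" by (simp add: s_def)
  have xk: "T x $ k = x $ k" for k by (simp add: x)
  have "T u $ k \<le> u $ k" for k
  proof (cases "k \<in> A")
    case True
    have "T u $ k \<le> T x $ k" using s by (intro mono_comp) (simp add: u_def)
    with True show ?thesis by (simp add: xk u_def)
  next
    case False
    then have "T u $ k = T (x - vec s) $ k"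
      by (intro eq_absorbing[OF abs]) (auto simp: u_def)
    with False show ?thesis by (simp add: shift_minus_comp xk u_def)
  qed
  then have "T u \<le> u" by (simp add: less_eq_vec_def)
  moreover have "x - vec s \<le> T (x - vec s)"
    by (simp add: less_eq_vec_def shift_minus_comp xk)
  moreover have "x - vec s \<le> u" using s by (simp add: less_eq_vec_def u_def)
  ultimately obtain z where z: "T z = z" "z \<le> u" "(\<lambda>n. (T ^^ n) u) \<longlonglongrightarrow> z"
    using monotone_iteration[OF mono continuous] by blast
  have "z $ d \<le> u $ d" using z(2) by (simp add: less_eq_vec_def)
  then have "z $ d \<le> x $ d - s" using d by (simp add: u_def)
  then have zl: "z $ l < x $ l - 1" for l using R[OF z(1), of d l] by (simp add: s_def)
  have "\<forall>\<^sub>F n in sequentially. (T ^^ n) u $ l < x $ l - 1" for l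
    using order_tendstoD(2)[OF tendsto_vec_nth[OF z(3)] zl] .
  then have "\<forall>\<^sub>F n in sequentially. \<forall>l. (T ^^ n) u $ l < x $ l - 1"
    by (rule eventually_all_finite)
  then have "\<forall>\<^sub>F n in sequentially. n > 0 \<and> (\<forall>l. (T ^^ n) u $ l < x $ l - 1)"
    using eventually_gt_at_top[of 0] by (rule eventually_elim2) simp
  then obtain n where n: "n > 0" "\<And>l. (T ^^ n) u $ l < x $ l - 1"
    using eventually_happens'[OF sequentially_bot] by blast
  \<comment> \<open>Convexity bounds \<open>T v\<close> by the average of the next iterates. The two
    averages differ by a telescoping sum, which is negative on the class because \<open>u\<close>
    equals \<open>x\<close> there.\<close>
  define v where "v = (\<Sum>m<n. (1 / real n) *\<^sub>R (T ^^ m) u)"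
  have "T v $ k < v $ k" if "k \<in> scc i" for k
  proof -
    have "k \<in> A" using that by (simp add: A_def scc_def)
    have "T v $ k \<le> (\<Sum>m<n. (1 / real n) * T ((T ^^ m) u) $ k)"
      unfolding v_def using n(1) by (intro convex_on_sum[OF _ _ convex]) auto
    also have "\<dots> = (1 / real n) * (\<Sum>m<n. (T ^^ Suc m) u $ k)"
      by (simp add: sum_distrib_left)
    also have "\<dots> < (1 / real n) * (\<Sum>m<n. (T ^^ m) u $ k)"
    proof -
      have "(\<Sum>m<n. (T ^^ Suc m) u $ k) - (\<Sum>m<n. (T ^^ m) u $ k) = (T ^^ n) u $ k - u $ k"
        unfolding sum_subtractf[symmetric] by (subst sum_lessThan_telescope) simp
      moreover have "u $ k = x $ k" using \<open>k \<in> A\<close> by (simp add: u_def)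
      ultimately have "(\<Sum>m<n. (T ^^ Suc m) u $ k) < (\<Sum>m<n. (T ^^ m) u $ k)"
        using n(2)[of k] by linarith
      then show ?thesis using n(1) by (intro mult_strict_left_mono) auto
    qed
    also have "(1 / real n) * (\<Sum>m<n. (T ^^ m) u $ k) = v $ k"
      by (simp add: v_def sum_distrib_left)
    finally show ?thesis .
  qed
  then show ?thesis by blast
qed

text \<open>Starting from \<open>x\<close> lowered outside the class, the decrease is carried
  backwards along arcs: an entry depending on a lowered one has room to be lowered itself, and this
  only decreases \<open>T\<close> at the entries treated before.\<close>

lemma nonfinal_class_strict_if_strict_mono:
  assumes x: "T x = x"
    and strict: "\<And>a b w. dep a b \<Longrightarrow> w \<le> x \<Longrightarrow> w $ b < x $ b \<Longrightarrow> T w $ a < T x $ a"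
    and i: "\<not> absorbing (scc i)"
  shows "\<exists>v. \<forall>k\<in>scc i. T v $ k < v $ k"
proof -
  define C where "C = scc i"
  define P where "P S \<longleftrightarrow> - C \<subseteq> S \<and> (\<exists>w. w \<le> x \<and> (\<forall>k. w $ k < x $ k \<longleftrightarrow> k \<in> S) \<and>
    (\<forall>k\<in>S \<inter> C. T w $ k < w $ k))" for S
  have "P (- C)"
    unfolding P_def
    by (intro conjI exI[of _ "\<chi> k. if k \<in> C then x $ k else x $ k - 1"])
      (auto simp: less_eq_vec_def)
  moreover have "\<exists>S'. S \<subset> S' \<and> P S'" if S: "P S" "S \<noteq> UNIV" for S
  proof -
    obtain l where l: "l \<notin> S" using S by auto
    then have "l \<in> C" using S by (auto simp: P_def)
    then obtain j where j: "j \<notin> C" "reach l j" using class_reaches_outside[OF i] C_def by blast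
    then have "j \<in> S" using S by (auto simp: P_def)
    with l j obtain a b where ab: "a \<notin> S" "b \<in> S" "dep a b"
      using rtranclp_crossing[of dep l j S] by blast
    obtain w where w: "w \<le> x" "\<And>k. w $ k < x $ k \<longleftrightarrow> k \<in> S" "\<And>k. k \<in> S \<inter> C \<Longrightarrow> T w $ k < w $ k"
      using S(1) by (auto simp: P_def)
    have "w $ a \<le> x $ a" using w(1) by (simp add: less_eq_vec_def)
    then have wa: "w $ a = x $ a" using w(2)[of a] ab(1) by simp
    have "T w $ a < x $ a" using strict[OF ab(3) w(1)] w(2) ab(2) x by simp
    then obtain r where r: "T w $ a < r" "r < x $ a" using dense by blast
    define w' where "w' = (\<chi> k. if k = a then r else w $ k)"
    have w'w: "w' $ k \<le> w $ k" for k using r wa by (simp add: w'_def)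
    have le: "T w' $ k \<le> T w $ k" for k using w'w by (rule mono_comp)
    have "T w' $ k < w' $ k" if "k \<in> insert a S \<inter> C" for k
      using that le[of k] w(3)[of k] r(1) by (cases "k = a") (auto simp: w'_def)
    moreover have "w' \<le> x" using w(1) w'w by (meson less_eq_vec_def order_trans)
    moreover have "w' $ k < x $ k \<longleftrightarrow> k \<in> insert a S" for k
      using w(2)[of k] r(2) by (simp add: w'_def)
    ultimately have "P (insert a S)" using S(1) by (auto simp: P_def)
    then show ?thesis using ab(1) by blast
  qed
  ultimately have "P UNIV" by (rule finite_growth_induct)
  then show ?thesis by (auto simp: P_def C_def)
qed

text \<open>Shift \<open>x\<close> until it lies below \<open>v\<close> on \<open>C\<close> and
  touches it at \<open>p\<close>; monotonicity then gives the inequality at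
  \<open>p\<close>.\<close>

lemma no_strict_supersolution:
  assumes C: "absorbing C" "C \<noteq> {}" and x: "\<And>i. i \<in> C \<Longrightarrow> T x $ i = x $ i"
  shows "\<exists>i\<in>C. v $ i \<le> T v $ i"
proof -
  define s where "s = Max ((\<lambda>i. x $ i - v $ i) ` C)"
  have s: "x $ i - v $ i \<le> s" if "i \<in> C" for i
    using that by (auto simp: s_def)
  have "s \<in> (\<lambda>i. x $ i - v $ i) ` C"
    unfolding s_def using C by (intro Max_in) auto
  then obtain p where p: "p \<in> C" "s = x $ p - v $ p" by auto
  have "(x - vec s) $ k \<le> v $ k" if "k \<in> C" for k using s[OF that] by simp
  then have "T (x - vec s) $ p \<le> T v $ p"
    using p(1) by (intro mono_absorbing[OF C(1)]) auto
  then show ?thesis using p x by (auto simp: shift_minus_comp)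
qed

end

section \<open>Logarithmic coordinates\<close>

lemma pos_vec_vexp [simp]: "pos_vec (vexp x)"
  by (simp add: pos_vec_def vexp_def)

lemma pos_vecE:
  assumes "pos_vec x"
  obtains y where "x = vexp y"
proof -
  have "x = vexp (\<chi> i. ln (x $ i))"
    using assms by (simp add: pos_vec_def vexp_def vec_eq_iff)
  then show thesis using that by blast
qed

lemma vexp_nth [simp]: "vexp x $ i = exp (x $ i)"
  by (simp add: vexp_def)

lemma hilbert_dist_vexp_le_iff:
  "hilbert_dist (vexp x) (vexp y) \<le> R \<longleftrightarrow> (\<forall>i j. (y $ i - x $ i) - (y $ j - x $ j) \<le> R)"
proof -
  define E where "E = {(vexp y $ i * vexp x $ j) / (vexp x $ i * vexp y $ j) | i j. True}"
  have "E = range (\<lambda>(i, j). exp ((y $ i - x $ i) - (y $ j - x $ j)))"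
  proof -
    have "(vexp y $ i * vexp x $ j) / (vexp x $ i * vexp y $ j) =
        exp ((y $ i - x $ i) - (y $ j - x $ j))" for i j
      by (simp add: exp_diff)
    then show ?thesis by (auto simp: E_def)
  qed
  moreover have "finite (range (\<lambda>(i, j). exp ((y $ i - x $ i) - (y $ j - x $ j))))" by simp
  ultimately have E: "E \<noteq> {}" "finite E" "\<And>a. a \<in> E \<Longrightarrow> a > 0"
    and le: "(\<forall>a\<in>E. a \<le> exp R) \<longleftrightarrow> (\<forall>i j. (y $ i - x $ i) - (y $ j - x $ j) \<le> R)"
    by auto
  have "Max E > 0" using E Max_in by blast
  then have "ln (Max E) \<le> R \<longleftrightarrow> Max E \<le> exp R"
    by (metis exp_le_cancel_iff exp_ln)
  also have "\<dots> \<longleftrightarrow> (\<forall>a\<in>E. a \<le> exp R)" using E by simp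
  finally show ?thesis using le by (simp add: hilbert_dist_def E_def)
qed

text \<open>Nonnegativity bounds the quotients below, which makes the real infimum genuine. The
  strict form avoids the question whether the infimum is attained.\<close>

lemma cw_radius_less_iff:
  assumes "\<And>x i. pos_vec x \<Longrightarrow> g x $ i \<ge> 0"
  shows "cw_radius g < c \<longleftrightarrow> (\<exists>x. pos_vec x \<and> (\<forall>i. g x $ i < c * x $ i))"
proof -
  define \<rho> where "\<rho> x = Max (range (\<lambda>i. g x $ i / x $ i))" for x
  have less: "\<rho> x < c \<longleftrightarrow> (\<forall>i. g x $ i < c * x $ i)" if "pos_vec x" for x
    using that by (auto simp: \<rho>_def pos_vec_def pos_divide_less_eq)
  have "\<rho> x \<ge> 0" if "pos_vec x" for x
  proof -
    have "0 \<le> g x $ i / x $ i" for i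
      using assms[OF that] that by (simp add: pos_vec_def less_imp_le)
    then show ?thesis
      unfolding \<rho>_def by (meson Max_ge finite finite_imageI order_trans rangeI)
  qed
  then have "bdd_below (\<rho> ` {x. pos_vec x})" by (intro bdd_belowI[of _ 0]) auto
  moreover have "{x :: real^'a. pos_vec x} \<noteq> {}" using pos_vec_vexp by blast
  ultimately have "cw_radius g < c \<longleftrightarrow> (\<exists>x\<in>{x. pos_vec x}. \<rho> x < c)"
    unfolding cw_radius_def \<rho>_def[symmetric] by (subst cInf_less_iff) auto
  then show ?thesis using less by auto
qed

section \<open>Real analytic functions along a coordinate direction\<close>

text \<open>On the line in direction \<open>j\<close> a monomial vanishes unless its multi-index is
  supported on \<open>j\<close>; \<open>\<iota> n\<close> is the multi-index with entry n at
  \<open>j\<close>, and \<open>0 ^ 0 = 1\<close> disposes of the other factors.\<close>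

lemma real_analytic_at_axis_powser:
  assumes "real_analytic_at h p"
  obtains a r where "r > 0" "\<And>s. \<bar>s\<bar> < r \<Longrightarrow> (\<lambda>n. a n * s ^ n) sums h (p + s *\<^sub>R axis j 1)"
proof -
  obtain c r where r: "r > 0" and c: "\<And>v. norm v < r \<Longrightarrow>
      ((\<lambda>\<alpha>. c \<alpha> * (\<Prod>i\<in>UNIV. (v $ i) ^ (\<alpha> i))) has_sum h (p + v)) UNIV"
    using assms unfolding real_analytic_at_def by blast
  define \<iota> where "\<iota> n = (\<lambda>i. if i = j then n else 0 :: nat)" for n
  have inj: "inj \<iota>"
  proof (rule injI)
    fix m n assume "\<iota> m = \<iota> n"
    then have "\<iota> m j = \<iota> n j" by simp
    then show "m = n" by (simp add: \<iota>_def)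
  qed
  have "(\<lambda>n. c (\<iota> n) * s ^ n) sums h (p + s *\<^sub>R axis j 1)" if "\<bar>s\<bar> < r" for s
  proof -
    define v :: "real^'a" where "v = s *\<^sub>R axis j 1"
    have v: "v $ i = (if i = j then s else 0)" for i by (simp add: v_def axis_def)
    have "norm v < r" using that by (simp add: v_def)
    note c[OF this]
    also have "((\<lambda>\<alpha>. c \<alpha> * (\<Prod>i\<in>UNIV. (v $ i) ^ (\<alpha> i))) has_sum h (p + v)) UNIV \<longleftrightarrow>
      ((\<lambda>\<alpha>. c \<alpha> * (\<Prod>i\<in>UNIV. (v $ i) ^ (\<alpha> i))) has_sum h (p + v)) (range \<iota>)"
    proof (rule has_sum_cong_neutral)
      fix \<alpha> assume \<alpha>: "\<alpha> \<in> UNIV - range \<iota>"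
      have "\<exists>i. i \<noteq> j \<and> \<alpha> i \<noteq> 0"
      proof (rule ccontr)
        assume "\<nexists>i. i \<noteq> j \<and> \<alpha> i \<noteq> 0"
        then have "\<alpha> i = \<iota> (\<alpha> j) i" for i by (auto simp: \<iota>_def)
        then have "\<alpha> = \<iota> (\<alpha> j)" by (rule ext)
        then have "\<alpha> \<in> range \<iota>" by (rule range_eqI)
        with \<alpha> show False by simp
      qed
      then obtain i where "i \<noteq> j" "\<alpha> i \<noteq> 0" by blast
      then have "\<exists>i\<in>UNIV. (v $ i) ^ (\<alpha> i) = 0" by (intro bexI[of _ i]) (simp_all add: v)
      then have "(\<Prod>i\<in>UNIV. (v $ i) ^ (\<alpha> i)) = 0" by (rule prod_zero[OF finite])
      then show "c \<alpha> * (\<Prod>i\<in>UNIV. (v $ i) ^ (\<alpha> i)) = 0" by simp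
    qed auto
    also have "\<dots> \<longleftrightarrow> ((\<lambda>n. c (\<iota> n) * (\<Prod>i\<in>UNIV. (v $ i) ^ (\<iota> n i))) has_sum h (p + v)) UNIV"
      by (subst has_sum_reindex[OF inj]) (simp add: o_def)
    also have "(\<lambda>n. c (\<iota> n) * (\<Prod>i\<in>UNIV. (v $ i) ^ (\<iota> n i))) = (\<lambda>n. c (\<iota> n) * s ^ n)"
    proof
      fix n
      have "(v $ i) ^ (\<iota> n i) = (if i = j then s ^ n else 1)" for i
        by (simp add: v \<iota>_def)
      then have "(\<Prod>i\<in>UNIV. (v $ i) ^ (\<iota> n i)) = (\<Prod>i\<in>UNIV. if i = j then s ^ n else 1)"
        by (intro prod.cong refl)
      then show "c (\<iota> n) * (\<Prod>i\<in>UNIV. (v $ i) ^ (\<iota> n i)) = c (\<iota> n) * s ^ n" by simp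
    qed
    finally show ?thesis unfolding v_def by (rule has_sum_imp_sums)
  qed
  from that[OF r this] show thesis .
qed

text \<open>Isolated zeros: if the power series of the difference to \<open>K\<close> had a nonzero
  coefficient, a punctured neighbourhood would be free of zeros, contrary to constancy on the
  left.\<close>

lemma real_analytic_at_constant_extend:
  assumes h: "real_analytic_at h p"
    and const: "\<eta> > 0" "\<And>s. -\<eta> < s \<Longrightarrow> s \<le> 0 \<Longrightarrow> h (p + s *\<^sub>R axis j 1) = K"
  shows "\<exists>d>0. \<forall>s. \<bar>s\<bar> < d \<longrightarrow> h (p + s *\<^sub>R axis j 1) = K"
proof -
  obtain a r where r: "r > 0" and a: "\<And>s. \<bar>s\<bar> < r \<Longrightarrow> (\<lambda>n. a n * s ^ n) sums h (p + s *\<^sub>R axis j 1)"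
    using real_analytic_at_axis_powser[OF h] by metis
  have K: "h p = K" using const(2)[of 0] const(1) by simp
  have a0: "a 0 = K"
    using sums_unique2[OF powser_sums_zero a[of 0]] r K by simp
  define b where "b n = (if n = 0 then 0 else a n)" for n
  have b: "(\<lambda>n. b n * (s - 0) ^ n) sums (h (p + s *\<^sub>R axis j 1) - K)" if "norm (s - 0) < r" for s
  proof -
    have "(\<lambda>n. a n * s ^ n - (if n = 0 then K else 0)) sums (h (p + s *\<^sub>R axis j 1) - K)"
      using that by (intro sums_diff a sums_single) auto
    moreover have "(\<lambda>n. a n * s ^ n - (if n = 0 then K else 0)) = (\<lambda>n. b n * (s - 0) ^ n)"
      by (auto simp: b_def a0)
    ultimately show ?thesis by simp
  qed
  have "b m = 0" for m
  proof (rule ccontr)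
    assume m: "b m \<noteq> 0"
    then have "m > 0" by (cases m) (auto simp: b_def)
    then obtain \<sigma> where \<sigma>: "\<sigma> > 0" "\<And>z. z \<in> cball 0 \<sigma> - {0} \<Longrightarrow> h (p + z *\<^sub>R axis j 1) - K \<noteq> 0"
      using powser_0_nonzero[OF r b _ m] K by (metis add_0_right diff_self scaleR_zero_left)
    define s where "s = - min \<sigma> (\<eta> / 2)"
    have "s \<in> cball 0 \<sigma> - {0}" "-\<eta> < s" "s \<le> 0" using \<sigma>(1) const(1) by (auto simp: s_def)
    then show False using \<sigma>(2)[of s] const(2)[of s] by simp
  qed
  then have "h (p + s *\<^sub>R axis j 1) = K" if "\<bar>s\<bar> < r" for s
    using b[of s] that by (simp add: sums_iff)
  with r show ?thesis by blast
qed

locale multiplicatively_convex =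
  fixes f :: "real^'n \<Rightarrow> real^'n"
  assumes maps_pos: "maps_pos f" and order_preserving: "order_preserving f"
    and homogeneous: "homogeneous f" and mult_convex: "mult_convex f"
begin

definition log_map :: "real \<Rightarrow> real^'n \<Rightarrow> real^'n" where
  "log_map c y = (\<chi> i. ln (f (vexp y) $ i) - c)"

lemma f_pos: "pos_vec x \<Longrightarrow> f x $ i > 0"
  using maps_pos by (simp add: maps_pos_def pos_vec_def)

lemma f_vexp: "f (vexp y) $ i = exp c * exp (log_map c y $ i)"
  using f_pos[OF pos_vec_vexp] by (simp add: log_map_def exp_diff)

lemma f_mono: "pos_vec x \<Longrightarrow> pos_vec y \<Longrightarrow> (\<And>k. x $ k \<le> y $ k) \<Longrightarrow> f x $ i \<le> f y $ i"
  using order_preserving by (simp add: order_preserving_def vle_def)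

lemma topical_log_map: "topical (log_map c)"
proof
  fix x y :: "real^'n" assume "x \<le> y"
  then have "f (vexp x) $ i \<le> f (vexp y) $ i" for i
    by (intro f_mono pos_vec_vexp) (simp add: less_eq_vec_def)
  then show "log_map c x \<le> log_map c y"
    using f_pos[OF pos_vec_vexp] by (simp add: log_map_def less_eq_vec_def)
next
  fix x :: "real^'n" and d
  have "vexp (x + vec d) = exp d *\<^sub>R vexp x"
    by (simp add: vec_eq_iff exp_add)
  then have "f (vexp (x + vec d)) = exp d *\<^sub>R f (vexp x)"
    using homogeneous by (simp add: homogeneous_def)
  moreover have "f (vexp x) $ i \<noteq> 0" for i using f_pos[OF pos_vec_vexp] by (metis less_irrefl)
  ultimately show "log_map c (x + vec d) = log_map c x + vec d"
    using f_pos[OF pos_vec_vexp] by (simp add: log_map_def vec_eq_iff ln_mult_pos)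
next
  fix i
  have "convex_on UNIV (\<lambda>y. ln (f (vexp y) $ i) + (- c))"
    using mult_convex by (intro convex_on_add) (auto simp: mult_convex_def convex_on_const)
  then show "convex_on UNIV (\<lambda>x. log_map c x $ i)" by (simp add: log_map_def)
qed

lemma log_map_less_iff: "log_map c y $ i < y $ i \<longleftrightarrow> f (vexp y) $ i < exp c * vexp y $ i"
  by (simp add: f_vexp[of _ _ c])

text \<open>Valid for every \<open>c\<close>, so all the maps \<open>log_map c\<close> share their
  graph and classes and the parameter can be chosen freely.\<close>

lemma garc_eq_dep: "garc f = topical.dep (log_map c)"
proof (intro ext iffI)
  interpret T: topical "log_map c" by (rule topical_log_map)
  fix i j :: 'n
  have unit: "unit_exp j t = vexp (0 + t *\<^sub>R axis j 1)" for t
    by (simp add: unit_exp_def vec_eq_iff axis_def)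
  have garc: "garc f i j \<longleftrightarrow> filterlim (\<lambda>t. exp c * exp (log_map c (0 + t *\<^sub>R axis j 1) $ i)) at_top at_top"
    unfolding garc_def unit f_vexp[of _ _ c] ..
  show "T.dep i j" if "garc f i j"
  proof (rule ccontr)
    assume "\<not> T.dep i j"
    then have "log_map c (0 + t *\<^sub>R axis j 1) $ i = log_map c 0 $ i" for t
      by (intro T.eq_off_independent) (auto simp: axis_def)
    then have "filterlim (\<lambda>t :: real. exp c * exp (log_map c 0 $ i)) at_top at_top"
      using that unfolding garc by simp
    then show False
      using filterlim_at_top_imp_at_infinity not_tendsto_and_filterlim_at_infinity[OF _ tendsto_const]
      by (metis trivial_limit_at_top_linorder)
  qed
  show "garc f i j" if "T.dep i j"
  proof -
    have "filterlim (\<lambda>t. log_map c (0 + t *\<^sub>R axis j 1) $ i) at_top at_top"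
      unfolding filterlim_at_top eventually_at_top_linorder using T.dep_unbounded[OF that] by blast
    then have "filterlim (\<lambda>t. exp (log_map c (0 + t *\<^sub>R axis j 1) $ i)) at_top at_top"
      by (rule filterlim_compose[OF exp_at_top])
    then show ?thesis
      unfolding garc by (rule filterlim_tendsto_pos_mult_at_top[OF tendsto_const exp_gt_zero])
  qed
qed

lemma scc_of_eq: "scc_of f = topical.scc (log_map c)"
  by (rule ext) (simp add: scc_of_def topical.scc_def[OF topical_log_map] garc_eq_dep[of c])

lemma final_class_iff:
  "final_class f C \<longleftrightarrow> (\<exists>i. C = topical.scc (log_map c) i) \<and> topical.absorbing (log_map c) C"
  unfolding final_class_def is_scc_def topical.absorbing_def[OF topical_log_map]
  by (simp add: scc_of_eq[of c] garc_eq_dep[of c])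

section \<open>Boundary values and Collatz-Wielandt radii\<close>

lemma cone_ext_bdd_below:
  assumes "nonneg_vec x"
  shows "bdd_below {f (x + e *\<^sub>R (\<chi> k. 1)) $ i | e. e > 0}"
proof (rule bdd_belowI[of _ 0])
  fix a assume "a \<in> {f (x + e *\<^sub>R (\<chi> k. 1)) $ i | e. e > 0}"
  then obtain e where "e > 0" "a = f (x + e *\<^sub>R (\<chi> k. 1)) $ i" by blast
  moreover from this have "pos_vec (x + e *\<^sub>R (\<chi> k. 1))"
    using assms by (simp add: pos_vec_def nonneg_vec_def add_nonneg_pos)
  ultimately show "0 \<le> a" using f_pos less_imp_le by blast
qed

lemma cone_ext_less_iff:
  assumes "nonneg_vec x"
  shows "cone_ext f x $ i < c \<longleftrightarrow> (\<exists>e>0. f (x + e *\<^sub>R (\<chi> k. 1)) $ i < c)"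
proof -
  have ne: "{f (x + e *\<^sub>R (\<chi> k. 1)) $ i | e. e > 0} \<noteq> {}" using zero_less_one by blast
  show ?thesis
    unfolding cone_ext_def vec_lambda_beta cInf_less_iff[OF ne cone_ext_bdd_below[OF assms]] by auto
qed

lemma nonneg_vec_proj0: "pos_vec x \<Longrightarrow> nonneg_vec (proj0 C x)"
  by (simp add: nonneg_vec_def proj0_def pos_vec_def less_imp_le)

lemma restr0_nonneg: "pos_vec x \<Longrightarrow> restr0 C f x $ i \<ge> 0"
proof -
  assume x: "pos_vec x"
  have "\<not> cone_ext f (proj0 C x) $ i < 0"
  proof
    assume "cone_ext f (proj0 C x) $ i < 0"
    then obtain e where "e > 0" "f (proj0 C x + e *\<^sub>R (\<chi> k. 1)) $ i < 0"
      using cone_ext_less_iff[OF nonneg_vec_proj0[OF x]] by blast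
    moreover from this(1) have "pos_vec (proj0 C x + e *\<^sub>R (\<chi> k. 1))"
      using nonneg_vec_proj0[OF x] by (simp add: pos_vec_def nonneg_vec_def add_nonneg_pos)
    ultimately show False using f_pos[of "proj0 C x + e *\<^sub>R (\<chi> k. 1)" i] by simp
  qed
  then show ?thesis by (simp add: restr0_def proj0_def)
qed

text \<open>The strict inequality leaves room to trade the zeros outside \<open>C\<close> for small
  positive entries, in both directions.\<close>

lemma cw_radius_restr0_less_iff:
  "cw_radius (restr0 C f) < exp c \<longleftrightarrow> (\<exists>v. \<forall>i\<in>C. log_map c v $ i < v $ i)"
proof -
  have "cw_radius (restr0 C f) < exp c \<longleftrightarrow>
      (\<exists>x. pos_vec x \<and> (\<forall>i. restr0 C f x $ i < exp c * x $ i))"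
    by (rule cw_radius_less_iff[OF restr0_nonneg])
  also have "\<dots> \<longleftrightarrow> (\<exists>x. pos_vec x \<and> (\<forall>i\<in>C. cone_ext f (proj0 C x) $ i < exp c * x $ i))"
    by (intro ex_cong1 conj_cong refl) (auto simp: restr0_def proj0_def pos_vec_def)
  also have "\<dots> \<longleftrightarrow> (\<exists>v. \<forall>i\<in>C. log_map c v $ i < v $ i)"
  proof
    assume "\<exists>x. pos_vec x \<and> (\<forall>i\<in>C. cone_ext f (proj0 C x) $ i < exp c * x $ i)"
    then obtain x where x: "pos_vec x" "\<forall>i\<in>C. cone_ext f (proj0 C x) $ i < exp c * x $ i" by blast
    have "\<forall>i. \<exists>e>0. i \<in> C \<longrightarrow> f (proj0 C x + e *\<^sub>R (\<chi> k. 1)) $ i < exp c * x $ i"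
      using x cone_ext_less_iff[OF nonneg_vec_proj0[OF x(1)]] by (meson zero_less_one)
    then obtain e where e: "\<And>i. e i > 0"
      "\<And>i. i \<in> C \<Longrightarrow> f (proj0 C x + e i *\<^sub>R (\<chi> k. 1)) $ i < exp c * x $ i"
      by metis
    \<comment> \<open>One perturbation that works for all indices in \<open>C\<close> at
      once.\<close>
    define d where "d = Min (range e)"
    have d: "d > 0" "\<And>i. d \<le> e i" using e(1) by (auto simp: d_def)
    have pos: "pos_vec (proj0 C x + t *\<^sub>R (\<chi> k. 1))" if "t > 0" for t
      using nonneg_vec_proj0[OF x(1)] that by (simp add: pos_vec_def nonneg_vec_def add_nonneg_pos)
    obtain v where v: "proj0 C x + d *\<^sub>R (\<chi> k. 1) = vexp v"
      using pos_vecE pos d(1) by blast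
    have "log_map c v $ i < v $ i" if "i \<in> C" for i
    proof -
      have "f (vexp v) $ i \<le> f (proj0 C x + e i *\<^sub>R (\<chi> k. 1)) $ i"
        unfolding v[symmetric] using d e(1) by (intro f_mono pos) auto
      also have "\<dots> < exp c * x $ i" by (rule e(2)[OF that])
      also have "\<dots> \<le> exp c * vexp v $ i"
        unfolding v[symmetric] using that d(1) by (simp add: proj0_def)
      finally show ?thesis by (simp only: log_map_less_iff)
    qed
    then show "\<exists>v. \<forall>i\<in>C. log_map c v $ i < v $ i" by blast
  next
    assume "\<exists>v. \<forall>i\<in>C. log_map c v $ i < v $ i"
    then obtain v where v: "\<And>i. i \<in> C \<Longrightarrow> f (vexp v) $ i < exp c * vexp v $ i"
      by (auto simp only: log_map_less_iff)
    define m where "m = Min (range (\<lambda>i. vexp v $ i))"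
    have m: "m > 0" "\<And>i. m \<le> vexp v $ i" by (auto simp: m_def)
    have "cone_ext f (proj0 C (vexp v)) $ i < exp c * vexp v $ i" if i: "i \<in> C" for i
    proof -
      \<comment> \<open>The slack at \<open>i\<close> as a factor. For \<open>t\<close> between 1
        and \<open>q\<close>, adding \<open>(t - 1) * m\<close> to every entry stays below
        \<open>t *\<^sub>R vexp v\<close>, since \<open>m\<close> is the least entry, and
        homogeneity evaluates \<open>f\<close> there.\<close>
      define q where "q = exp c * vexp v $ i / f (vexp v) $ i"
      have fi: "f (vexp v) $ i > 0" using f_pos pos_vec_vexp by blast
      have "q > 1" using v[OF i] fi by (simp add: q_def)
      then obtain t where t: "1 < t" "t < q" using dense by blast
      define y where "y = proj0 C (vexp v) + ((t - 1) * m) *\<^sub>R (\<chi> k. 1)"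
      have "pos_vec y"
        using nonneg_vec_proj0[OF pos_vec_vexp, of C v] t m(1)
        by (simp add: y_def pos_vec_def nonneg_vec_def add_nonneg_pos)
      moreover have "pos_vec (t *\<^sub>R vexp v)" using t(1) by (simp add: pos_vec_def)
      moreover have "y $ k \<le> (t *\<^sub>R vexp v) $ k" for k
      proof -
        have "(t - 1) * m \<le> (t - 1) * vexp v $ k" using t m(2) by (intro mult_left_mono) auto
        moreover have "proj0 C (vexp v) $ k \<le> vexp v $ k" by (simp add: proj0_def)
        ultimately show ?thesis by (simp add: y_def algebra_simps)
      qed
      ultimately have "f y $ i \<le> f (t *\<^sub>R vexp v) $ i" by (rule f_mono)
      also have "\<dots> = t * f (vexp v) $ i"
        using homogeneous t(1) by (simp add: homogeneous_def)
      also have "\<dots> < exp c * vexp v $ i" using t(2) fi by (simp add: q_def field_simps)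
      finally show ?thesis
        using t(1) m(1) by (auto simp: cone_ext_less_iff[OF nonneg_vec_proj0[OF pos_vec_vexp]] y_def
          intro!: exI[of _ "(t - 1) * m"])
    qed
    then show "\<exists>x. pos_vec x \<and> (\<forall>i\<in>C. cone_ext f (proj0 C x) $ i < exp c * x $ i)"
      using pos_vec_vexp by blast
  qed
  finally show ?thesis .
qed

lemma cw_radius_less_exp_iff: "cw_radius f < exp c \<longleftrightarrow> (\<exists>v. \<forall>i. log_map c v $ i < v $ i)"
proof -
  have "cw_radius f < exp c \<longleftrightarrow> (\<exists>x. pos_vec x \<and> (\<forall>i. f x $ i < exp c * x $ i))"
    by (rule cw_radius_less_iff) (simp add: f_pos less_imp_le)
  then show ?thesis
    unfolding log_map_less_iff using pos_vecE pos_vec_vexp by metis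
qed

text \<open>A fixed point on \<open>C\<close> excludes strict supersolutions for \<open>c\<close>.
  For a larger parameter \<open>x\<close> itself is one, so \<open>r\<close> above
  \<open>exp c\<close> would give \<open>r < r\<close> at the parameter \<open>ln r\<close>. Stated
  for a general \<open>r\<close> to cover both \<open>f\<close> and its restrictions.\<close>

lemma eq_exp_of_less_iff:
  assumes r: "\<And>c. r < exp c \<longleftrightarrow> (\<exists>v. \<forall>i\<in>C. log_map c v $ i < v $ i)"
    and C: "topical.absorbing (log_map c) C" "C \<noteq> {}"
    and x: "\<And>i. i \<in> C \<Longrightarrow> log_map c x $ i = x $ i"
  shows "r = exp c"
proof (rule antisym)
  show "exp c \<le> r"
    using topical.no_strict_supersolution[OF topical_log_map C x] r[of c] by (meson not_le)
  show "r \<le> exp c"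
  proof (rule ccontr)
    assume *: "\<not> r \<le> exp c"
    then have "r > 0" using exp_gt_zero[of c] by linarith
    then have "c < ln r" using * by (metis exp_ln exp_less_cancel_iff not_le)
    then have "\<forall>i\<in>C. log_map (ln r) x $ i < x $ i"
      using x by (fastforce simp: log_map_def)
    then have "r < exp (ln r)" using r by blast
    with \<open>r > 0\<close> show False by simp
  qed
qed

lemmas cw_radius_restr0_eq = eq_exp_of_less_iff[OF cw_radius_restr0_less_iff]

lemma cw_radius_eq: "log_map c x = x \<Longrightarrow> cw_radius f = exp c"
  using eq_exp_of_less_iff[of "cw_radius f" UNIV c x] cw_radius_less_exp_iff
    topical.absorbing_UNIV[OF topical_log_map] by simp

lemma vexp_in_eigvecs_iff: "vexp x \<in> eigvecs f \<longleftrightarrow> (\<exists>c. log_map c x = x)"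
proof
  assume "vexp x \<in> eigvecs f"
  then obtain \<mu> where \<mu>: "f (vexp x) = \<mu> *\<^sub>R vexp x" by (auto simp: eigvecs_def)
  \<comment> \<open>Names an index, where positivity of \<open>f\<close> yields
    \<open>\<mu> > 0\<close>.\<close>
  obtain i :: 'n where True by simp
  have "\<mu> > 0" using f_pos[OF pos_vec_vexp, of x i] by (simp add: \<mu> zero_less_mult_iff)
  then have "log_map (ln \<mu>) x = x" by (simp add: log_map_def \<mu> vec_eq_iff ln_mult_pos)
  then show "\<exists>c. log_map c x = x" ..
next
  assume "\<exists>c. log_map c x = x"
  then obtain c where c: "log_map c x = x" ..
  have "f (vexp x) = exp c *\<^sub>R vexp x" by (simp add: vec_eq_iff f_vexp[of _ _ c] c)
  then show "vexp x \<in> eigvecs f" using pos_vec_vexp by (auto simp: eigvecs_def)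
qed

text \<open>If \<open>\<psi>\<close> were flat on the interval from \<open>- \<delta>\<close> to 0,
  it would be flat up to a last point, being unbounded. Analyticity of \<open>f\<close> there
  extends the flat piece past its end.\<close>

lemma log_map_strict_mono_if_analytic:
  assumes an: "real_analytic_map f" and dep: "topical.dep (log_map c) a b"
    and w: "w \<le> x" "w $ b < x $ b"
  shows "log_map c w $ a < log_map c x $ a"
proof -
  interpret T: topical "log_map c" by (rule topical_log_map)
  define \<psi> where "\<psi> \<tau> = log_map c (x + \<tau> *\<^sub>R axis b 1) $ a" for \<tau>
  define \<delta> where "\<delta> = x $ b - w $ b"
  have \<delta>: "\<delta> > 0" using w(2) by (simp add: \<delta>_def)
  have \<psi>_mono: "\<psi> s \<le> \<psi> t" if "s \<le> t" for s t
    unfolding \<psi>_def using that by (intro T.mono_comp) (auto simp: axis_def)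
  have "log_map c w $ a \<le> \<psi> (- \<delta>)"
    unfolding \<psi>_def using w(1) by (intro T.mono_comp) (auto simp: axis_def \<delta>_def less_eq_vec_def)
  moreover have "\<psi> (- \<delta>) \<noteq> \<psi> 0"
  proof
    assume eq: "\<psi> (- \<delta>) = \<psi> 0"
    have cont: "continuous_on UNIV \<psi>"
      unfolding \<psi>_def
      by (rule continuous_on_compose2[OF T.continuous_comp]) (auto intro!: continuous_intros)
    define A where "A = {\<tau>. \<psi> \<tau> \<le> \<psi> 0}"
    have "closed A" unfolding A_def by (intro closed_Collect_le cont continuous_intros)
    obtain t0 where t0: "\<forall>t\<ge>t0. \<psi> t \<ge> \<psi> 0 + 1"
      using T.dep_unbounded[OF dep, of "\<psi> 0 + 1" x] by (auto simp: \<psi>_def)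
    have bdd: "bdd_above A"
    proof (rule bdd_aboveI)
      fix t assume "t \<in> A"
      then show "t \<le> t0" using t0 by (auto simp: A_def not_le[symmetric] dest!: spec[of _ t])
    qed
    have "0 \<in> A" by (simp add: A_def)
    then have S: "Sup A \<in> A" "0 \<le> Sup A"
      using closed_contains_Sup[OF _ bdd \<open>closed A\<close>] cSup_upper[OF _ bdd] by auto
    have const: "\<psi> t = \<psi> 0" if "- \<delta> \<le> t" "t \<le> Sup A" for t
      using \<psi>_mono[OF that(1)] \<psi>_mono[OF that(2)] S(1) eq by (simp add: A_def)
    \<comment> \<open>The right end of the flat piece in the original coordinates, where analyticity
      is available. Additive steps along axis \<open>b\<close> from \<open>p\<close> follow the same
      line as logarithmic ones, only reparametrised; \<open>\<eta>\<close> is the length there of a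
      flat piece of logarithmic length \<open>\<delta>\<close>.\<close>
    define p where "p = vexp (x + Sup A *\<^sub>R axis b 1)"
    have pb: "p $ b = exp (x $ b + Sup A)" by (simp add: p_def axis_def)
    have line: "f (p + s *\<^sub>R axis b 1) $ a = exp c * exp (\<psi> (ln (p $ b + s) - x $ b))"
      if "p $ b + s > 0" for s
    proof -
      have "p + s *\<^sub>R axis b 1 = vexp (x + (ln (p $ b + s) - x $ b) *\<^sub>R axis b 1)"
        using that by (auto simp: vec_eq_iff p_def axis_def)
      then show ?thesis by (simp add: f_vexp[of _ _ c] \<psi>_def)
    qed
    define \<eta> where "\<eta> = p $ b - exp (x $ b + Sup A - \<delta>)"
    have \<eta>: "\<eta> > 0" using \<delta> by (simp add: \<eta>_def pb)
    have left: "f (p + s *\<^sub>R axis b 1) $ a = exp c * exp (\<psi> 0)" if s: "- \<eta> < s" "s \<le> 0" for s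
    proof -
      have gt: "p $ b + s > exp (x $ b + Sup A - \<delta>)" using s(1) by (simp add: \<eta>_def)
      then have pos: "p $ b + s > 0" using exp_gt_zero less_trans by blast
      have "ln (p $ b + s) > x $ b + Sup A - \<delta>" using gt pos by (metis exp_ln exp_less_cancel_iff)
      moreover have "ln (p $ b + s) \<le> x $ b + Sup A"
        using s(2) pos pb by (metis exp_le_cancel_iff exp_ln add_le_same_cancel1)
      ultimately have "\<psi> (ln (p $ b + s) - x $ b) = \<psi> 0" using S(2) by (intro const) auto
      then show ?thesis by (simp add: line[OF pos])
    qed
    have an_p: "real_analytic_at (\<lambda>y. f y $ a) p"
      using an by (simp add: real_analytic_map_def p_def)
    obtain d where d: "d > 0" "\<And>s. \<bar>s\<bar> < d \<Longrightarrow> f (p + s *\<^sub>R axis b 1) $ a = exp c * exp (\<psi> 0)"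
      using real_analytic_at_constant_extend[where h = "\<lambda>y. f y $ a" and j = b, OF an_p \<eta> left]
      by blast
    define t where "t = ln (p $ b + d / 2) - x $ b"
    have pos: "p $ b + d / 2 > 0" using d(1) by (simp add: pb add_pos_pos)
    have "exp c * exp (\<psi> t) = exp c * exp (\<psi> 0)"
      using d line[OF pos] by (simp add: t_def)
    then have "t \<in> A" by (simp add: A_def)
    moreover have "t > Sup A"
    proof -
      have "x $ b + Sup A = ln (p $ b)" by (simp add: pb)
      also have "\<dots> < ln (p $ b + d / 2)"
        using d(1) pos pb by (subst ln_less_cancel_iff) simp_all
      finally show ?thesis by (simp add: t_def)
    qed
    ultimately show False using cSup_upper[OF _ bdd] by force
  qed
  moreover have "\<psi> (- \<delta>) \<le> \<psi> 0" using \<delta> by (intro \<psi>_mono) simp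
  ultimately show ?thesis by (simp add: \<psi>_def)
qed

subsection \<open>Strong nonnegativity\<close>

lemma final_class_eigenvector:
  assumes "final_class f C"
  obtains c x where "cw_radius (restr0 C f) = exp c" "\<And>k. k \<in> C \<Longrightarrow> log_map c x $ k = x $ k"
proof -
  interpret T: topical "log_map 0" by (rule topical_log_map)
  from assms obtain i where i: "C = T.scc i" and C: "T.absorbing C"
    using final_class_iff[of C 0] by blast
  have ne: "C \<noteq> {}" using i T.scc_refl by blast
  have "T.reach k l" if "k \<in> C" "l \<in> C" for k l using that T.scc_reach i by blast
  then obtain x c where x: "\<And>k. k \<in> C \<Longrightarrow> log_map 0 x $ k = x $ k + c"
    using T.strongly_connected_eigenvector[OF C ne] by blast
  \<comment> \<open>The additive eigenvalue found with parameter 0 becomes the new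
    parameter.\<close>
  then have x': "log_map c x $ k = x $ k" if "k \<in> C" for k
    using x[OF that] by (simp add: log_map_def)
  have "topical.absorbing (log_map c) C"
    using final_class_iff[of C c] assms by blast
  then have "cw_radius (restr0 C f) = exp c"
    using cw_radius_restr0_eq ne x' by blast
  then show thesis using x' by (rule that)
qed

text \<open>A final class always exists and its radius is the exponential of its own eigenvalue.
  Equality of radii makes the radius of \<open>f\<close> positive and gives all final classes the
  common parameter \<open>c\<close>.\<close>

lemma strongly_nonnegD:
  assumes sn: "strongly_nonneg f"
  obtains c where "cw_radius f = exp c"
    "\<And>i. topical.absorbing (log_map c) (topical.scc (log_map c) i) \<Longrightarrow>
       \<exists>x. \<forall>k\<in>topical.scc (log_map c) i. log_map c x $ k = x $ k"
    "\<And>i. \<not> topical.absorbing (log_map c) (topical.scc (log_map c) i) \<Longrightarrow>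
       \<exists>v. \<forall>k\<in>topical.scc (log_map c) i. log_map c v $ k < v $ k"
proof -
  have final: "\<exists>x. \<forall>k\<in>C. log_map (ln (cw_radius f)) x $ k = x $ k" and pos: "cw_radius f > 0"
    if C: "final_class f C" for C
  proof -
    obtain c x where cx: "cw_radius (restr0 C f) = exp c" "\<And>k. k \<in> C \<Longrightarrow> log_map c x $ k = x $ k"
      using final_class_eigenvector[OF C] by blast
    have eq: "cw_radius f = exp c" using sn C cx(1) by (simp add: strongly_nonneg_def)
    then show "\<exists>x. \<forall>k\<in>C. log_map (ln (cw_radius f)) x $ k = x $ k" using cx(2) by auto
    show "cw_radius f > 0" by (simp add: eq)
  qed
  define c where "c = ln (cw_radius f)"
  interpret T: topical "log_map c" by (rule topical_log_map)
  obtain i where "T.absorbing (T.scc i)" using T.reach_absorbing_class by blast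
  then have "final_class f (T.scc i)" using final_class_iff[of _ c] by blast
  then have c: "cw_radius f = exp c" using pos by (simp add: c_def)
  show thesis
  proof (rule that[OF c])
    show "\<exists>x. \<forall>k\<in>T.scc i. log_map c x $ k = x $ k" if "T.absorbing (T.scc i)" for i
      using final[of "T.scc i"] that final_class_iff[of "T.scc i" c] by (auto simp: c_def)
    show "\<exists>v. \<forall>k\<in>T.scc i. log_map c v $ k < v $ k" if "\<not> T.absorbing (T.scc i)" for i
    proof -
      have "is_scc f (T.scc i)" by (auto simp: is_scc_def scc_of_eq[of c])
      moreover have "\<not> final_class f (T.scc i)" using that final_class_iff[of _ c] by blast
      ultimately have "cw_radius (restr0 (T.scc i) f) < exp c"
        using sn c by (simp add: strongly_nonneg_def)
      then show ?thesis by (simp only: cw_radius_restr0_less_iff)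
    qed
  qed
qed

lemma strongly_nonnegI:
  assumes x: "log_map c x = x"
    and nonfinal: "\<And>i. \<not> topical.absorbing (log_map c) (topical.scc (log_map c) i) \<Longrightarrow>
       \<exists>v. \<forall>k\<in>topical.scc (log_map c) i. log_map c v $ k < v $ k"
  shows "strongly_nonneg f"
  unfolding strongly_nonneg_def
proof (intro conjI allI impI)
  interpret T: topical "log_map c" by (rule topical_log_map)
  have r: "cw_radius f = exp c" by (rule cw_radius_eq[OF x])
  fix C
  show "cw_radius (restr0 C f) = cw_radius f" if C: "final_class f C"
  proof -
    have "T.absorbing C" "C \<noteq> {}"
      using C T.scc_refl final_class_iff[of C c] by blast+
    then show ?thesis using cw_radius_restr0_eq[where C = C and c = c and x = x] x r by simp
  qed
  show "cw_radius (restr0 C f) < cw_radius f" if C: "is_scc f C \<and> \<not> final_class f C"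
  proof -
    obtain i where i: "C = T.scc i" using C by (auto simp: is_scc_def scc_of_eq[of c])
    then have "\<not> T.absorbing (T.scc i)" using C final_class_iff[of C c] by blast
    then show ?thesis unfolding r cw_radius_restr0_less_iff i by (rule nonfinal)
  qed
qed

lemma eigvecsE:
  assumes "y \<in> eigvecs f"
  obtains c x where "y = vexp x" "log_map c x = x"
proof -
  have "pos_vec y" using assms by (simp add: eigvecs_def)
  then obtain x where "y = vexp x" by (rule pos_vecE)
  with assms that show thesis using vexp_in_eigvecs_iff by blast
qed

section \<open>The implications between eigenvectors and strong nonnegativity\<close>

theorem eigvecs_nonempty_if_strongly_nonneg:
  assumes "strongly_nonneg f"
  shows "eigvecs f \<noteq> {}"
proof -
  obtain c where c:
    "\<And>i. topical.absorbing (log_map c) (topical.scc (log_map c) i) \<Longrightarrow>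
       \<exists>x. \<forall>k\<in>topical.scc (log_map c) i. log_map c x $ k = x $ k"
    "\<And>i. \<not> topical.absorbing (log_map c) (topical.scc (log_map c) i) \<Longrightarrow>
       \<exists>v. \<forall>k\<in>topical.scc (log_map c) i. log_map c v $ k < v $ k"
    using strongly_nonnegD[OF assms] by metis
  obtain x where "log_map c x = x"
    using topical.fixpoint_exists[OF topical_log_map c] by blast
  then show ?thesis using vexp_in_eigvecs_iff by blast
qed

theorem hbounded_if_unique_final_class:
  assumes sn: "strongly_nonneg f" and unique: "\<exists>!C. final_class f C"
  shows "hbounded (eigvecs f)"
proof -
  obtain c where c: "cw_radius f = exp c"
    and nonfinal: "\<And>i. \<not> topical.absorbing (log_map c) (topical.scc (log_map c) i) \<Longrightarrow>
       \<exists>v. \<forall>k\<in>topical.scc (log_map c) i. log_map c v $ k < v $ k"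
    using strongly_nonnegD[OF sn] by metis
  interpret T: topical "log_map c" by (rule topical_log_map)
  have final: "final_class f (T.scc i) \<longleftrightarrow> T.absorbing (T.scc i)" for i
    using final_class_iff[of _ c] by blast
  obtain p where p: "T.absorbing (T.scc p)" using T.reach_absorbing_class by blast
  have "T.scc i = T.scc p" if "T.absorbing (T.scc i)" for i
    using unique p that final by blast
  then obtain B where B: "\<And>z i. log_map c z = z \<Longrightarrow> \<bar>z $ i - z $ p\<bar> \<le> B"
    using T.fixpoints_bounded[OF _ p nonfinal] by blast
  \<comment> \<open>The eigenvalue is determined by the radius, so all eigenvectors are fixed points
    of one and the same map.\<close>
  have fix_c: "log_map c x = x" if "log_map d x = x" for d x
    using that cw_radius_eq[OF that] c by simp
  show ?thesis
    unfolding hbounded_def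
  \<comment> \<open>Two vectors at two indices: four deviations from the entry at \<open>p\<close>,
    each at most \<open>B\<close>.\<close>
  proof (intro exI[of _ "4 * B"] ballI)
    fix a b assume "a \<in> eigvecs f" "b \<in> eigvecs f"
    then obtain x y where xy: "a = vexp x" "b = vexp y" "log_map c x = x" "log_map c y = y"
      using eigvecsE fix_c by metis
    have "(y $ i - x $ i) - (y $ j - x $ j) \<le> 4 * B" for i j
      using B[OF xy(3), of i] B[OF xy(3), of j] B[OF xy(4), of i] B[OF xy(4), of j] by linarith
    then show "hilbert_dist a b \<le> 4 * B" by (simp only: xy(1,2) hilbert_dist_vexp_le_iff) blast
  qed
qed

theorem strongly_nonneg_if_hbounded:
  assumes ne: "eigvecs f \<noteq> {}" and bdd: "hbounded (eigvecs f)"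
  shows "strongly_nonneg f" "\<exists>!C. final_class f C"
proof -
  obtain c x where x: "log_map c x = x" using ne eigvecsE by blast
  interpret T: topical "log_map c" by (rule topical_log_map)
  obtain R where R: "\<And>a b. a \<in> eigvecs f \<Longrightarrow> b \<in> eigvecs f \<Longrightarrow> hilbert_dist a b \<le> R"
    using bdd by (auto simp: hbounded_def)
  have bound: "(x $ k - z $ k) - (x $ l - z $ l) \<le> R" if "log_map c z = z" for z k l
  proof -
    have "hilbert_dist (vexp z) (vexp x) \<le> R"
      using x that by (intro R) (auto simp: vexp_in_eigvecs_iff)
    then show ?thesis by (simp only: hilbert_dist_vexp_le_iff)
  qed
  show "strongly_nonneg f"
    using strongly_nonnegI[OF x T.nonfinal_class_strict_if_bounded[OF x bound]] by blast
  obtain p where p: "T.absorbing (T.scc p)" using T.reach_absorbing_class by blast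
  show "\<exists>!C. final_class f C"
  proof (rule ex1I)
    show "final_class f (T.scc p)" using p final_class_iff[of _ c] by blast
    show "C = T.scc p" if "final_class f C" for C
      using that p final_class_iff[of C c] T.final_class_unique[OF x bound] by blast
  qed
qed

theorem strongly_nonneg_if_analytic:
  assumes an: "real_analytic_map f" and ne: "eigvecs f \<noteq> {}"
  shows "strongly_nonneg f"
proof -
  obtain c x where x: "log_map c x = x" using ne eigvecsE by blast
  note strict = log_map_strict_mono_if_analytic[OF an, of c]
  show ?thesis
    by (rule strongly_nonnegI[OF x topical.nonfinal_class_strict_if_strict_mono[OF topical_log_map x strict]])
qed

end

theorem theorem4p4:
  fixes f :: "real^'n \<Rightarrow> real^'n"
  assumes "maps_pos f" and "order_preserving f" and "homogeneous f" and "mult_convex f"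
  shows "((eigvecs f \<noteq> {} \<and> hbounded (eigvecs f))
             \<longleftrightarrow> (strongly_nonneg f \<and> (\<exists>!C. final_class f C)))
         \<and> (strongly_nonneg f \<longrightarrow> eigvecs f \<noteq> {})
         \<and> (real_analytic_map f \<and> eigvecs f \<noteq> {} \<longrightarrow> strongly_nonneg f)"
proof -
  interpret multiplicatively_convex f
    using assms by unfold_locales
  show ?thesis
    using eigvecs_nonempty_if_strongly_nonneg hbounded_if_unique_final_class
      strongly_nonneg_if_hbounded strongly_nonneg_if_analytic by argo
qed

end
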